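(* Let $F=f+h$ be as in the context, and suppose $f$ is H\"older smooth with exponent $\nu\in[0,1)$ and constant $L_\nu>0$. Let $y_0\in\operatorname{dom}F$, $\beta\in(0,1)$, and suppose there is a constant $D>0$ with $D\ge \sup\{\operatorname{dist}(x,X^\star)\mid F(x)\le F(y_0)\}$. Let $\epsilon\in(0,F(y_0)-F^\star)$ and choose $\rho=c\,\epsilon/D^2$ for any fixed $c>0$. Then the classical proximal bundle method, started at $y_0$ with parameters $\rho,\beta$, finds an outer iterate $y_k$ satisfying $F(y_k)-F^\star\le\epsilon$ within a total number of (inner) iterations $$\mathcal{O}\!\left(\frac{L_\nu^{\frac{2}{1+\nu}}D^2}{\beta(1-\beta)^{\frac{1-\nu}{1+\nu}}\epsilon^{\frac{2}{1+\nu}}}\right)$$ as $\epsilon\downarrow0$ with all other data fixed, where the hidden constant depends only on $\nu$ and $c$ (that is, the bound holds with such a constant for all sufficiently small $\epsilon$).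
   Context: Problem. $F=f+h$ on $\mathbb{R}^n$, where $f:\mathbb{R}^n\to\mathbb{R}$ is finite-valued and convex and $h:\mathbb{R}^n\to\mathbb{R}\cup\{+\infty\}$ is proper, lower semicontinuous and convex. $F$ attains its minimum value $F^\star$; $X^\star=\{x\mid F(x)=F^\star\}\neq\emptyset$. $\partial$ is the convex subdifferential, $\|\cdot\|$ the Euclidean norm, $\operatorname{dist}(x,X^\star)$ the Euclidean distance. H\"older smoothness with exponent $\nu\in[0,1]$ and constant $L_\nu$: $\|g_x-g_y\|\le L_\nu\|x-y\|^\nu$ for all $x,y\in\mathbb{R}^n$ and all $g_x\in\partial f(x)$, $g_y\in\partial f(y)$ (for $\nu=0$ the right-hand side is $L_0$). Inner procedure ProxBundle with center $\bar x\in\operatorname{dom}F$, parameter $\rho>0$ and a stopping test. Set $z_0=\bar x$. For $j=0,1,2,\dots$: choose any convex model $f_j:\mathbb{R}^n\to\mathbb{R}$ such that (1) $f_j(x)\le f(x)$ for all $x$; (2) for some $g_j\in\partial f(z_j)$, $f_j(x)\ge f(z_j)+\langle g_j,x-z_j\rangle$ for all $x$; (3) if $j\ge1$, there exist $a_j\in\partial f_{j-1}(z_j)$ and $b_j\in\partial h(z_j)$ with $a_j+b_j=\rho(\bar x-z_j)$ such that $f_j(x)\ge f_{j-1}(z_j)+\langle a_j,x-z_j\rangle$ for all $x$. Let $F_j=f_j+h$ and $z_{j+1}=\arg\min_x\{F_j(x)+\frac{\rho}{2}\|x-\bar x\|^2\}$. If the stopping test holds, stop and return $z_{j+1}$; otherwise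 continue with $j+1$. Each value of $j$ is one inner iteration. Classical proximal bundle method (PBM): given $y_0\in\operatorname{dom}F$, $\rho>0$, $\beta\in(0,1)$, for $k=0,1,2,\dots$ (outer iterations) let $y_{k+1}$ be the output of ProxBundle with center $\bar x=y_k$ and the descent test $$F(y_k)-F(z_{j+1})\ge\beta\big(F(y_k)-F_j(z_{j+1})\big).$$ The total number of iterations is the sum over outer iterations of the numbers of inner iterations. *)

theory Defs
  imports "HOL-Analysis.Analysis" "HOL-Library.Poly_Mapping"
begin

section \<open>Euclidean spaces of varying dimension\<close>

text \<open>
  The complexity constant must not depend on the dimension, so the dimension \<open>n\<close> has to be
  quantified inside the statement and cannot be a type. Vectors are therefore finitely supported
  sequences, equipped with their standard inner product, and \<open>\<real>\<^sup>n\<close> is the subspace of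
  the sequences supported in \<open>{..<n}\<close>.
\<close>

instantiation poly_mapping :: (type, real_vector) real_vector
begin

lift_definition scaleR_poly_mapping :: "real \<Rightarrow> ('a \<Rightarrow>\<^sub>0 'b) \<Rightarrow> ('a \<Rightarrow>\<^sub>0 'b)"
  is "\<lambda>r f k. r *\<^sub>R f k"
  by (rule finite_subset) auto

instance
  by standard (transfer, simp add: fun_eq_iff scaleR_right_distrib scaleR_left_distrib)+

end

lemma lookup_scaleR [simp]: "Poly_Mapping.lookup (r *\<^sub>R x) k = r *\<^sub>R Poly_Mapping.lookup x k"
  by transfer simp

instantiation poly_mapping :: (type, real_inner) real_inner
begin

definition inner_poly_mapping :: "('a \<Rightarrow>\<^sub>0 'b) \<Rightarrow> ('a \<Rightarrow>\<^sub>0 'b) \<Rightarrow> real"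
  where "inner_poly_mapping x y =
    (\<Sum>k\<in>Poly_Mapping.keys x. inner (Poly_Mapping.lookup x k) (Poly_Mapping.lookup y k))"

definition norm_poly_mapping :: "('a \<Rightarrow>\<^sub>0 'b) \<Rightarrow> real"
  where "norm_poly_mapping x = sqrt (inner x x)"

definition sgn_poly_mapping :: "('a \<Rightarrow>\<^sub>0 'b) \<Rightarrow> ('a \<Rightarrow>\<^sub>0 'b)"
  where "sgn_poly_mapping x = x /\<^sub>R norm x"

definition dist_poly_mapping :: "('a \<Rightarrow>\<^sub>0 'b) \<Rightarrow> ('a \<Rightarrow>\<^sub>0 'b) \<Rightarrow> real"
  where "dist_poly_mapping x y = norm (x - y)"

definition uniformity_poly_mapping :: "(('a \<Rightarrow>\<^sub>0 'b) \<times> ('a \<Rightarrow>\<^sub>0 'b)) filter"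
  where "uniformity_poly_mapping = (INF e\<in>{0<..}. principal {(x, y). dist x y < e})"

definition open_poly_mapping :: "('a \<Rightarrow>\<^sub>0 'b) set \<Rightarrow> bool"
  where "open_poly_mapping U \<longleftrightarrow>
    (\<forall>x\<in>U. eventually (\<lambda>(x', y). x' = x \<longrightarrow> y \<in> U) uniformity)"

lemma inner_poly_mapping_superset:
  fixes x y :: "'a \<Rightarrow>\<^sub>0 'b"
  assumes "finite K" "Poly_Mapping.keys x \<subseteq> K"
  shows "inner x y = (\<Sum>k\<in>K. inner (Poly_Mapping.lookup x k) (Poly_Mapping.lookup y k))"
  unfolding inner_poly_mapping_def using assms
  by (intro sum.mono_neutral_left) (auto simp: in_keys_iff)

instance
proof
  fix x y z :: "'a \<Rightarrow>\<^sub>0 'b" and r :: real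
  let ?K = "Poly_Mapping.keys x \<union> Poly_Mapping.keys y"
  have K: "finite ?K" "Poly_Mapping.keys x \<subseteq> ?K"
    "Poly_Mapping.keys y \<subseteq> ?K" "Poly_Mapping.keys (x + y) \<subseteq> ?K"
    by (auto simp: keys_add in_keys_iff lookup_add)
  have S: "Poly_Mapping.keys (r *\<^sub>R x) \<subseteq> Poly_Mapping.keys x"
    by (auto simp: in_keys_iff)
  show "dist x y = norm (x - y)" by (rule dist_poly_mapping_def)
  show "sgn x = x /\<^sub>R norm x" by (rule sgn_poly_mapping_def)
  show "(uniformity :: (('a \<Rightarrow>\<^sub>0 'b) \<times> ('a \<Rightarrow>\<^sub>0 'b)) filter) =
      (INF e\<in>{0<..}. principal {(x, y). dist x y < e})"
    by (rule uniformity_poly_mapping_def)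
  show "open U \<longleftrightarrow> (\<forall>x\<in>U. eventually (\<lambda>(x', y). x' = x \<longrightarrow> y \<in> U) uniformity)"
    for U :: "('a \<Rightarrow>\<^sub>0 'b) set"
    by (rule open_poly_mapping_def)
  show "norm x = sqrt (inner x x)" by (rule norm_poly_mapping_def)
  show "inner x y = inner y x"
    unfolding inner_poly_mapping_superset[OF K(1,2)] inner_poly_mapping_superset[OF K(1,3)]
    by (simp add: inner_commute)
  show "inner (x + y) z = inner x z + inner y z"
    unfolding inner_poly_mapping_superset[OF K(1,2)] inner_poly_mapping_superset[OF K(1,3)]
      inner_poly_mapping_superset[OF K(1,4)]
    by (simp add: Poly_Mapping.lookup_add inner_add_left sum.distrib)
  show "inner (r *\<^sub>R x) y = r * inner x y"
    unfolding inner_poly_mapping_superset[OF finite_keys S]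
    by (simp add: inner_poly_mapping_def sum_distrib_left)
  show "0 \<le> inner x x"
    by (simp add: inner_poly_mapping_def sum_nonneg)
  show "inner x x = 0 \<longleftrightarrow> x = 0"
    by (auto simp: inner_poly_mapping_def sum_nonneg_eq_0_iff in_keys_iff intro!: poly_mapping_eqI)
qed

end

type_synonym rvec = "nat \<Rightarrow>\<^sub>0 real"

definition Rn :: "nat \<Rightarrow> rvec set"
  where "Rn n = {x. Poly_Mapping.keys x \<subseteq> {..<n}}"

lemma inner_Rn:
  assumes "x \<in> Rn n"
  shows "inner x y = (\<Sum>i<n. Poly_Mapping.lookup x i * Poly_Mapping.lookup y i)"
  using inner_poly_mapping_superset[of "{..<n}" x y] assms by (simp add: Rn_def)

lemma norm_Rn:
  assumes "x \<in> Rn n"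
  shows "norm x = sqrt (\<Sum>i<n. (Poly_Mapping.lookup x i)\<^sup>2)"
  using inner_Rn[OF assms] by (simp add: norm_eq_sqrt_inner power2_eq_square)

lemma subspace_Rn: "subspace (Rn n)"
  by (auto simp: subspace_def Rn_def subset_iff in_keys_iff lookup_add) (metis add.left_neutral)


section \<open>Convex composite minimisation\<close>

text \<open>
  Functions are considered on a set \<open>S\<close> (always \<open>Rn n\<close> in the statement); their values
  outside \<open>S\<close> are irrelevant. Functions with values in \<open>\<real> \<union> {\<infinity>}\<close> are \<open>ereal\<close>-valued functions
  that avoid \<open>-\<infinity>\<close>.
\<close>

definition proper_on :: "'a set \<Rightarrow> ('a \<Rightarrow> ereal) \<Rightarrow> bool"
  where "proper_on S h \<longleftrightarrow> (\<forall>x\<in>S. h x \<noteq> -\<infinity>) \<and> (\<exists>x\<in>S. h x \<noteq> \<infinity>)"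

definition lsc_on :: "'a::topological_space set \<Rightarrow> ('a \<Rightarrow> ereal) \<Rightarrow> bool"
  where "lsc_on S h \<longleftrightarrow> (\<forall>x\<in>S. h x \<le> Liminf (at x within S) h)"

definition ereal_convex_on :: "'a::real_vector set \<Rightarrow> ('a \<Rightarrow> ereal) \<Rightarrow> bool"
  where "ereal_convex_on S h \<longleftrightarrow> convex S \<and>
    (\<forall>x\<in>S. \<forall>y\<in>S. \<forall>u>0. \<forall>v>0. u + v = 1 \<longrightarrow>
       h (u *\<^sub>R x + v *\<^sub>R y) \<le> ereal u * h x + ereal v * h y)"

definition subdiff :: "'a::real_inner set \<Rightarrow> ('a \<Rightarrow> ereal) \<Rightarrow> 'a \<Rightarrow> 'a set"
  where "subdiff S h x = {g \<in> S. \<bar>h x\<bar> \<noteq> \<infinity> \<and> (\<forall>y\<in>S. h x + ereal (inner g (y - x)) \<le> h y)}"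

text \<open>The case \<open>\<nu> = 0\<close> is separate because \<open>0 powr 0 = 0\<close>.\<close>

definition holder_smooth_on :: "'a::real_inner set \<Rightarrow> ('a \<Rightarrow> real) \<Rightarrow> real \<Rightarrow> real \<Rightarrow> bool"
  where "holder_smooth_on S f \<nu> L \<longleftrightarrow>
    (\<forall>x\<in>S. \<forall>y\<in>S. \<forall>gx\<in>subdiff S (\<lambda>u. ereal (f u)) x. \<forall>gy\<in>subdiff S (\<lambda>u. ereal (f u)) y.
       norm (gx - gy) \<le> (if \<nu> = 0 then L else L * norm (x - y) powr \<nu>))"

definition composite :: "('a \<Rightarrow> real) \<Rightarrow> ('a \<Rightarrow> ereal) \<Rightarrow> 'a \<Rightarrow> ereal"
  where "composite f h x = ereal (f x) + h x"

definition min_value :: "'a set \<Rightarrow> ('a \<Rightarrow> ereal) \<Rightarrow> ereal"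
  where "min_value S F = (INF x\<in>S. F x)"

text \<open>The infimum is attained if and only if \<open>solution_set S F\<close> is nonempty.\<close>

definition solution_set :: "'a set \<Rightarrow> ('a \<Rightarrow> ereal) \<Rightarrow> 'a set"
  where "solution_set S F = {x \<in> S. F x = min_value S F}"


section \<open>The proximal bundle method\<close>

text \<open>
  \<open>m j\<close> is the model \<open>f\<^sub>j\<close> and \<open>z j\<close> the point \<open>z\<^sub>j\<close> of one inner run with center \<open>c\<close>.
\<close>

definition admissible_model ::
  "'a::real_inner set \<Rightarrow> ('a \<Rightarrow> real) \<Rightarrow> ('a \<Rightarrow> ereal) \<Rightarrow> real \<Rightarrow> 'a \<Rightarrow>
   (nat \<Rightarrow> 'a \<Rightarrow> real) \<Rightarrow> (nat \<Rightarrow> 'a) \<Rightarrow> nat \<Rightarrow> bool"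
  where "admissible_model S f h \<rho> c m z j \<longleftrightarrow>
    convex_on S (m j) \<and>
    (\<forall>x\<in>S. m j x \<le> f x) \<and>
    (\<exists>g\<in>subdiff S (\<lambda>u. ereal (f u)) (z j).
       \<forall>x\<in>S. m j x \<ge> f (z j) + inner g (x - z j)) \<and>
    (j \<ge> 1 \<longrightarrow>
      (\<exists>a\<in>subdiff S (\<lambda>u. ereal (m (j - 1) u)) (z j). \<exists>b\<in>subdiff S h (z j).
         a + b = \<rho> *\<^sub>R (c - z j) \<and>
         (\<forall>x\<in>S. m j x \<ge> m (j - 1) (z j) + inner a (x - z j))))"

text \<open>
  A run consists of the inner iterations \<open>j < J\<close>, where \<open>J = \<infinity>\<close> if the stopping test never
  holds; \<open>test p w\<close> is the stopping test for \<open>p = f\<^sub>j\<close> and \<open>w = z\<^sub>j\<^sub>+\<^sub>1\<close>. For finite \<open>J\<close> the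
  output is \<open>z J\<close>.
\<close>

definition prox_bundle_run ::
  "'a::real_inner set \<Rightarrow> ('a \<Rightarrow> real) \<Rightarrow> ('a \<Rightarrow> ereal) \<Rightarrow> real \<Rightarrow> 'a \<Rightarrow>
   (('a \<Rightarrow> real) \<Rightarrow> 'a \<Rightarrow> bool) \<Rightarrow> enat \<Rightarrow> (nat \<Rightarrow> 'a \<Rightarrow> real) \<Rightarrow> (nat \<Rightarrow> 'a) \<Rightarrow> bool"
  where "prox_bundle_run S f h \<rho> c test J m z \<longleftrightarrow>
    J \<ge> 1 \<and> z 0 = c \<and>
    (\<forall>j. enat j < J \<longrightarrow>
       admissible_model S f h \<rho> c m z j \<and>
       is_arg_min (\<lambda>x. composite (m j) h x + ereal (\<rho> / 2 * (norm (x - c))\<^sup>2))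
         (\<lambda>x. x \<in> S) (z (Suc j)) \<and>
       (test (m j) (z (Suc j)) \<longleftrightarrow> enat (Suc j) = J))"

definition descent_test ::
  "('a \<Rightarrow> real) \<Rightarrow> ('a \<Rightarrow> ereal) \<Rightarrow> real \<Rightarrow> 'a \<Rightarrow> ('a \<Rightarrow> real) \<Rightarrow> 'a \<Rightarrow> bool"
  where "descent_test f h \<beta> c p w \<longleftrightarrow>
    composite f h c - composite f h w \<ge> ereal \<beta> * (composite f h c - composite p h w)"

text \<open>
  \<open>y k\<close> are the outer iterates, \<open>J k\<close> is the number of inner iterations of outer iteration \<open>k\<close>,
  and \<open>m k\<close>, \<open>z k\<close> are its models and points. If \<open>J i = \<infinity>\<close>, the method never leaves outer
  iteration \<open>i\<close>, and the data with index \<open>k > i\<close> are meaningless and unconstrained.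
\<close>

definition pbm_run ::
  "'a::real_inner set \<Rightarrow> ('a \<Rightarrow> real) \<Rightarrow> ('a \<Rightarrow> ereal) \<Rightarrow> real \<Rightarrow> real \<Rightarrow> 'a \<Rightarrow>
   (nat \<Rightarrow> 'a) \<Rightarrow> (nat \<Rightarrow> enat) \<Rightarrow> (nat \<Rightarrow> nat \<Rightarrow> 'a \<Rightarrow> real) \<Rightarrow> (nat \<Rightarrow> nat \<Rightarrow> 'a) \<Rightarrow> bool"
  where "pbm_run S f h \<rho> \<beta> y0 y J m z \<longleftrightarrow>
    y 0 = y0 \<and>
    (\<forall>k. (\<forall>i<k. J i \<noteq> \<infinity>) \<longrightarrow>
       prox_bundle_run S f h \<rho> (y k) (descent_test f h \<beta> (y k)) (J k) (m k) (z k) \<and>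
       (\<forall>r. J k = enat r \<longrightarrow> y (Suc k) = z k r))"

end

theory Submission
  imports Defs
begin

text \<open>
  In an outer iteration with center \<open>c\<close> and gap \<open>\<Delta> = F c - F\<^sup>*\<close>, let \<open>e\<^sub>j\<close> be the Moreau envelope at \<open>c\<close>
  minus the optimal value of the \<open>j\<close>-th subproblem, and \<open>G\<^sub>j\<close> the model gap \<open>f - f\<^sub>j\<close> at \<open>z\<^sub>j\<^sub>+\<^sub>1\<close>.
  A subgradient of the model is a \<open>G\<^sub>j\<close>-subgradient of \<open>f\<close>, so by Hoelder smoothness it differs from a
  subgradient of \<open>f\<close> by at most \<open>2 L\<^sup>p\<^sup>/\<^sup>2 G\<^sub>j\<^sup>1\<^sup>-\<^sup>p\<^sup>/\<^sup>2\<close>, where \<open>p = 2 / (1 + \<nu>)\<close>; hence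
  \<open>e\<^sub>j\<^sub>+\<^sub>1 \<le> e\<^sub>j - \<rho> g\<^sup>p / (8 L\<^sup>p)\<close> for every \<open>g \<le> G\<^sub>j\<close> with \<open>\<rho> g\<^sup>p\<^sup>-\<^sup>1 \<le> 4 L\<^sup>p\<close>.
  In a null step \<open>G\<^sub>j \<ge> max e\<^sub>j \<eta>\<close>, where \<open>\<eta>\<close> is \<open>(1 - \<beta>) \<Delta>\<close> up to a constant, so there are
  \<open>O(L\<^sup>p / (\<rho> \<eta>\<^sup>p\<^sup>-\<^sup>1))\<close> null steps. Keeping \<open>e\<^sub>j\<close> and \<open>\<eta>\<close> apart is what yields the exponent \<open>p - 1\<close>
  rather than \<open>p\<close> of \<open>1 - \<beta>\<close>. A descent step shrinks \<open>\<Delta>\<close> by a factor \<open>1 - \<kappa> \<beta>\<close>, so the bounds of the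
  outer iterations form a geometric sum that is dominated by \<open>\<Delta> = \<epsilon>\<close>. Small \<open>\<epsilon>\<close> (hence small \<open>\<rho>\<close>)
  guarantees \<open>\<rho> g\<^sup>p\<^sup>-\<^sup>1 \<le> 4 L\<^sup>p\<close> for \<open>g = max e\<^sub>j \<eta>\<close> from the first inner iteration on.
\<close>

section \<open>Existence of subgradients on \<open>Rn n\<close>\<close>

lemma lookup_outside_Rn: "x \<in> Rn n \<Longrightarrow> n \<le> k \<Longrightarrow> Poly_Mapping.lookup x k = 0"
  by (metis Rn_def in_keys_iff lessThan_iff mem_Collect_eq not_le subsetD)

lemma Rn_mono: "k \<le> n \<Longrightarrow> Rn k \<subseteq> Rn n"
  by (auto simp: Rn_def)

lemma inner_single_Rn:
  fixes x :: rvec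
  shows "inner (Poly_Mapping.single k 1) x = Poly_Mapping.lookup x k"
  by (simp add: inner_poly_mapping_def)

lemma Rn_Suc_decompose:
  assumes "d \<in> Rn (Suc k)"
  shows "d - Poly_Mapping.lookup d k *\<^sub>R Poly_Mapping.single k 1 \<in> Rn k"
  using assms
  by (auto simp: Rn_def subset_iff in_keys_iff lookup_minus lookup_single when_def less_Suc_eq)

text \<open>A Hahn-Banach extension by hand: the base point \<open>x\<close> stays fixed in
  \<open>Rn n\<close>, and a subgradient for directions in \<open>Rn k\<close> is extended by one
  coordinate at a time. Hoelder smoothness compares existing subgradients only, so existence has to
  come from convexity.\<close>

lemma convex_on_Rn_subgradient:
  fixes f :: "rvec \<Rightarrow> real"
  assumes f: "convex_on (Rn n) f" and x: "x \<in> Rn n"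
  shows "k \<le> n \<Longrightarrow> \<exists>g\<in>Rn k. \<forall>d\<in>Rn k. f x + inner g d \<le> f (x + d)"
proof (induction k)
  case 0
  have "Rn 0 = {0}"
    by (auto simp: Rn_def)
  then show ?case
    by simp
next
  case (Suc k)
  then obtain g where g: "g \<in> Rn k" and sub: "\<And>d. d \<in> Rn k \<Longrightarrow> f x + inner g d \<le> f (x + d)"
    by auto
  define e :: rvec where "e = Poly_Mapping.single k 1"
  have e: "e \<in> Rn (Suc k)"
    by (auto simp: e_def Rn_def)
  have eg: "inner e d = 0" if "d \<in> Rn k" for d
    using that by (simp add: e_def inner_single_Rn lookup_outside_Rn)
  have ee: "inner e e = 1"
    by (simp add: e_def inner_single_Rn)
  have kn: "Rn k \<subseteq> Rn n" "Rn (Suc k) \<subseteq> Rn n"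
    using Suc.prems Rn_mono by (auto dest: Suc_leD)
  have in_n: "x + d + s *\<^sub>R e \<in> Rn n" if "d \<in> Rn k" for d s
    using x that e kn by (meson subset_iff subspace_Rn subspace_add subspace_scale)
  \<comment> \<open>Each element is a lower bound that the inequality for a backward step
    \<open>- s\<close> forces on the new slope. \<open>cross\<close> shows that no such bound
    exceeds an upper bound forced by a forward step, so the supremum is a valid slope.\<close>
  define lo where "lo = {(f x + inner g d - f (x + d + (- s) *\<^sub>R e)) / s | d s. d \<in> Rn k \<and> s > 0}"
  have cross: "(f x + inner g d - f (x + d + (- s) *\<^sub>R e)) / s
      \<le> (f (x + d' + t *\<^sub>R e) - f x - inner g d') / t"
    if "d \<in> Rn k" "d' \<in> Rn k" "s > 0" "t > 0" for d d' s t
  proof -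
    \<comment> \<open>With these weights the \<open>e\<close>-components cancel, so the combined
      point has a displacement in \<open>Rn k\<close>, where \<open>sub\<close> applies.\<close>
    let ?u = "t / (s + t)" and ?v = "s / (s + t)"
    have uv: "?u + ?v = 1" "?u \<ge> 0" "?v \<ge> 0"
      using that by (auto simp: divide_simps)
    have st: "?u * s = ?v * t"
      by simp
    have "f x + inner g (?u *\<^sub>R d + ?v *\<^sub>R d') \<le> f (x + (?u *\<^sub>R d + ?v *\<^sub>R d'))"
      using that by (intro sub) (meson subspace_Rn subspace_add subspace_scale)
    also have "x + (?u *\<^sub>R d + ?v *\<^sub>R d') = (?u + ?v) *\<^sub>R x + (?u *\<^sub>R d + ?v *\<^sub>R d')"
      unfolding uv by simp
    also have "\<dots> = ?u *\<^sub>R (x + d + (- s) *\<^sub>R e) + ?v *\<^sub>R (x + d' + t *\<^sub>R e)"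
      using st by (simp add: algebra_simps)
    also have "f \<dots> \<le> ?u * f (x + d + (- s) *\<^sub>R e) + ?v * f (x + d' + t *\<^sub>R e)"
      using f uv that in_n[of d "-s"] in_n[of d' t] unfolding convex_on_def by blast
    finally have "(s + t) * (f x + inner g (?u *\<^sub>R d + ?v *\<^sub>R d'))
        \<le> (s + t) * (?u * f (x + d + (- s) *\<^sub>R e) + ?v * f (x + d' + t *\<^sub>R e))"
      using that by (intro mult_left_mono) auto
    moreover have "(s + t) * (?u * r) = t * r" "(s + t) * (?v * r) = s * r" for r
      using that by auto
    ultimately have "(s + t) * f x + (t * inner g d + s * inner g d')
        \<le> t * f (x + d + (- s) *\<^sub>R e) + s * f (x + d' + t *\<^sub>R e)"
      by (simp only: distrib_left[of "s + t"] inner_add_right inner_scaleR_right)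
    then show ?thesis
      using that by (simp add: field_simps)
  qed
  have 0: "0 \<in> Rn k"
    by (simp add: Rn_def)
  have bdd: "bdd_above lo"
    unfolding lo_def using cross[OF _ 0 _ zero_less_one] by (auto intro!: bdd_aboveI)
  have "(f x + inner g 0 - f (x + 0 + (- 1) *\<^sub>R e)) / 1 \<in> lo"
    unfolding lo_def using 0 by (intro CollectI exI[of _ 0] exI[of _ 1]) auto
  then have ne: "lo \<noteq> {}"
    by blast
  define \<alpha> where "\<alpha> = Sup lo"
  have above: "f x + inner g d + \<alpha> * s \<le> f (x + d + s *\<^sub>R e)" if d: "d \<in> Rn k" for d s
  proof (cases s "0 :: real" rule: linorder_cases)
    case less
    then have "(f x + inner g d - f (x + d + (- (- s)) *\<^sub>R e)) / (- s) \<in> lo"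
      using d unfolding lo_def by (intro CollectI exI[of _ d] exI[of _ "- s"]) auto
    then have "(f x + inner g d - f (x + d + (- (- s)) *\<^sub>R e)) / (- s) \<le> \<alpha>"
      unfolding \<alpha>_def by (rule cSup_upper[OF _ bdd])
    then show ?thesis
      using less by (simp add: field_simps)
  next
    case equal
    then show ?thesis
      using sub[OF d] by simp
  next
    case greater
    then have "\<alpha> \<le> (f (x + d + s *\<^sub>R e) - f x - inner g d) / s"
      unfolding \<alpha>_def using cross d by (intro cSup_least[OF ne]) (auto simp: lo_def)
    then show ?thesis
      using greater by (simp add: field_simps)
  qed
  show ?case
  proof (intro bexI ballI)
    show "g + \<alpha> *\<^sub>R e \<in> Rn (Suc k)"
      using g e Rn_mono[of k "Suc k"] by (meson le_SucI order_refl subset_iff subspace_Rn subspace_add subspace_scale)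
    fix d assume d: "d \<in> Rn (Suc k)"
    define s where "s = Poly_Mapping.lookup d k"
    define d' where "d' = d - s *\<^sub>R e"
    have d': "d' \<in> Rn k" "d = d' + s *\<^sub>R e"
      using Rn_Suc_decompose[OF d] by (simp_all add: d'_def s_def e_def)
    show "f x + inner (g + \<alpha> *\<^sub>R e) d \<le> f (x + d)"
      using above[OF d'(1), of s] eg[OF d'(1)] eg[OF g] ee
      by (simp add: d'(2) inner_add_left inner_add_right inner_commute[of g e] add.assoc mult.commute)
  qed
qed

lemma subdiff_ereal_iff:
  "g \<in> subdiff S (\<lambda>u. ereal (f u)) x \<longleftrightarrow> g \<in> S \<and> (\<forall>y\<in>S. f x + inner g (y - x) \<le> f y)"
  by (simp add: subdiff_def)

lemma subdiff_Rn_nonempty: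
  assumes "convex_on (Rn n) f" "x \<in> Rn n"
  shows "subdiff (Rn n) (\<lambda>u. ereal (f u)) x \<noteq> {}"
proof -
  obtain g where "g \<in> Rn n" and g: "\<And>d. d \<in> Rn n \<Longrightarrow> f x + inner g d \<le> f (x + d)"
    using convex_on_Rn_subgradient[OF assms order_refl] by blast
  moreover have "f x + inner g (y - x) \<le> f y" if "y \<in> Rn n" for y
    using g[of "y - x"] that assms(2) subspace_diff[OF subspace_Rn] by simp
  ultimately have "g \<in> subdiff (Rn n) (\<lambda>u. ereal (f u)) x"
    by (simp add: subdiff_ereal_iff)
  then show ?thesis
    by blast
qed

section \<open>Scalar recursions\<close>

text \<open>Both elementary bounds, \<open>ln r \<le> r - 1\<close> and
  \<open>1 + u \<le> exp u\<close>, lose in the same direction at \<open>r = y / x\<close>.\<close>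

lemma powr_minus_tangent:
  fixes a x y :: real
  assumes "0 < a" "0 < x" "0 < y"
  shows "y powr - a \<ge> x powr - a - a * x powr - (1 + a) * (y - x)"
proof -
  have "1 - a * (y / x - 1) \<le> 1 - a * ln (y / x)"
    using assms ln_le_minus_one[of "y / x"] by (simp add: mult_left_mono)
  also have "\<dots> \<le> (y / x) powr - a"
    using assms exp_ge_add_one_self[of "- a * ln (y / x)"] by (simp add: powr_def)
  finally have "(1 - a * (y / x - 1)) * x powr - a \<le> (y / x) powr - a * x powr - a"
    by (intro mult_right_mono) auto
  also have "\<dots> = y powr - a"
    using assms by (simp flip: powr_mult)
  also have "x powr - a = x powr - (1 + a) * x"
    using assms powr_add[of x "- (1 + a)" 1] by simp
  also have "(1 - a * (y / x - 1)) * (x powr - (1 + a) * x)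
      = x powr - (1 + a) * x - a * x powr - (1 + a) * (y - x)"
    using assms by (simp add: field_simps)
  also have "x powr - (1 + a) * x = x powr - a"
    using assms powr_add[of x "- (1 + a)" 1] by simp
  finally show ?thesis .
qed

text \<open>A discrete version of the differential equation
  \<open>e' = - K * max e \<eta> powr (1 + a)\<close>. Every step lowers the potential
  \<open>V\<close> by at least \<open>K\<close>, and
  \<open>V \<le> (1 + 1 / a) * \<eta> powr - a\<close> everywhere, so the count does not depend on
  \<open>e 0\<close>.\<close>

lemma power_decrease_step_count:
  fixes e :: "nat \<Rightarrow> real" and a K \<eta> :: real and T :: nat
  assumes "0 < a" "0 < K" "0 < \<eta>"
    and nonneg: "\<And>j. j \<le> T \<Longrightarrow> 0 \<le> e j"
    and step: "\<And>j. j < T \<Longrightarrow> e (Suc j) \<le> e j - K * max (e j) \<eta> powr (1 + a)"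
  shows "T \<le> (1 + 1 / a) / (K * \<eta> powr a)"
proof -
  \<comment> \<open>the concave function with derivative \<open>1 / max s \<eta> powr (1 + a)\<close> that vanishes at 0\<close>
  define V where "V s = (if s \<le> \<eta> then s * \<eta> powr - (1 + a)
    else \<eta> powr - a + (\<eta> powr - a - s powr - a) / a)" for s
  have \<eta>: "\<eta> * \<eta> powr - (1 + a) = \<eta> powr - a"
    using assms powr_add[of \<eta> 1 "- (1 + a)"] by simp
  have tangent: "V t \<le> V s - max s \<eta> powr - (1 + a) * (s - t)" if "t \<le> s" "0 \<le> t" for s t
  proof (cases "s \<le> \<eta>")
    case True
    then show ?thesis
      using that by (simp add: V_def max_def algebra_simps)
  next
    case s: False
    \<comment> \<open>The upper branch of \<open>V\<close>, continued to all \<open>u > 0\<close>,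
      stays below the tangent at \<open>s\<close>. Taking \<open>u = \<eta>\<close>, where the
      branches meet, handles \<open>t\<close> in the linear branch, whose slope is at least that of
      the tangent.\<close>
    have outer: "\<eta> powr - a + (\<eta> powr - a - u powr - a) / a \<le> V s - s powr - (1 + a) * (s - u)"
      if "u > 0" for u
    proof -
      have "s powr - a - u powr - a \<le> a * (s powr - (1 + a) * (u - s))"
        using powr_minus_tangent[of a s u] that s assms by (simp add: mult.assoc)
      then have "(s powr - a - u powr - a) / a \<le> s powr - (1 + a) * (u - s)"
        using assms by (simp add: pos_divide_le_eq mult.commute)
      then show ?thesis
        using s by (simp add: V_def diff_divide_distrib right_diff_distrib)
    qed
    show ?thesis
    proof (cases "t \<le> \<eta>")
      case True
      have "V t = \<eta> powr - a - \<eta> powr - (1 + a) * (\<eta> - t)"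
        using True \<eta> by (simp add: V_def algebra_simps)
      also have "\<dots> \<le> \<eta> powr - a - s powr - (1 + a) * (\<eta> - t)"
        using s True assms by (intro diff_left_mono mult_right_mono powr_mono2') auto
      also have "\<dots> \<le> V s - s powr - (1 + a) * (s - t)"
        using outer[of \<eta>] assms by (simp add: algebra_simps)
      finally show ?thesis
        using s by (simp add: max_def)
    next
      case False
      then show ?thesis
        using outer[of t] s assms by (simp add: max_def V_def)
    qed
  qed
  have potential: "V (e j) + K * j \<le> V (e 0)" if "j \<le> T" for j
    using that
  proof (induction j)
    case (Suc j)
    have pos: "max (e j) \<eta> > 0"
      using assms by simp
    have "0 \<le> K * max (e j) \<eta> powr (1 + a)"
      using assms by simp
    then have "V (e (Suc j)) \<le> V (e j) - max (e j) \<eta> powr - (1 + a) * (e j - e (Suc j))"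
      using Suc.prems step[of j] nonneg[of "Suc j"] by (intro tangent) auto
    also have "\<dots> \<le> V (e j) - max (e j) \<eta> powr - (1 + a) * (K * max (e j) \<eta> powr (1 + a))"
      using Suc.prems step[of j] by (intro diff_left_mono mult_left_mono) auto
    also have "max (e j) \<eta> powr - (1 + a) * (K * max (e j) \<eta> powr (1 + a)) = K"
      using pos powr_add[of "max (e j) \<eta>" "- (1 + a)" "1 + a"] by simp
    finally show ?case
      using Suc by (simp add: algebra_simps)
  qed simp
  have "0 \<le> V (e T)"
    using assms nonneg[of T] powr_mono2'[of "- a" \<eta> "e T"] by (auto simp: V_def intro!: add_nonneg_nonneg divide_nonneg_nonneg)
  moreover have "V (e 0) \<le> (1 + 1 / a) * \<eta> powr - a"
  proof (cases "e 0 \<le> \<eta>")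
    case True
    then have "V (e 0) \<le> \<eta> powr - a"
      unfolding \<eta>[symmetric] by (simp add: V_def mult_right_mono)
    also have "\<dots> \<le> (1 + 1 / a) * \<eta> powr - a"
      using assms by (simp add: algebra_simps)
    finally show ?thesis .
  next
    case False
    then show ?thesis
      using assms by (simp add: V_def field_simps)
  qed
  ultimately have "K * T \<le> (1 + 1 / a) * \<eta> powr - a"
    using potential[of T] by simp
  then show ?thesis
    using assms by (simp add: powr_minus field_simps)
qed

text \<open>Read backwards from \<open>k\<close>, the terms shrink at least by the ratio
  \<open>1 / (1 + a * q)\<close>, because \<open>(1 - q) powr - a \<ge> 1 + a * q\<close>. The
  geometric series with this ratio sums to \<open>1 + 1 / (a * q)\<close>.\<close>

lemma sum_powr_geometric_le:
  fixes \<Delta> :: "nat \<Rightarrow> real"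
  assumes a: "0 < a" and q: "0 < q" "q < 1"
    and pos: "\<And>i. i \<le> k \<Longrightarrow> 0 < \<Delta> i"
    and decr: "\<And>i. i < k \<Longrightarrow> \<Delta> (Suc i) \<le> (1 - q) * \<Delta> i"
  shows "(\<Sum>i\<le>k. \<Delta> i powr - a) \<le> (1 + 1 / (a * q)) * \<Delta> k powr - a"
  using pos decr
proof (induction k)
  case 0
  then show ?case
    using a q by (simp add: field_simps)
next
  case (Suc k)
  let ?B = "1 + 1 / (a * q)"
  have pos: "0 < \<Delta> k" "0 < \<Delta> (Suc k)"
    using Suc.prems by auto
  have "1 + a * q \<le> (1 - q) powr - a"
    using powr_minus_tangent[of a 1 "1 - q"] a q by simp
  then have "(1 + a * q) * \<Delta> k powr - a \<le> (1 - q) powr - a * \<Delta> k powr - a"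
    by (rule mult_right_mono) simp
  also have "\<dots> = ((1 - q) * \<Delta> k) powr - a"
    using q pos by (simp add: powr_mult)
  also have "\<dots> \<le> \<Delta> (Suc k) powr - a"
    using Suc.prems(2)[of k] a pos by (intro powr_mono2') auto
  finally have *: "(1 + a * q) * \<Delta> k powr - a \<le> \<Delta> (Suc k) powr - a" .
  have "?B * \<Delta> k powr - a = ((1 + a * q) * \<Delta> k powr - a) / (a * q)"
    using a q by (simp add: field_simps)
  also have "\<dots> \<le> \<Delta> (Suc k) powr - a / (a * q)"
    using * a q by (intro divide_right_mono) auto
  finally have "?B * \<Delta> k powr - a \<le> \<Delta> (Suc k) powr - a / (a * q)" .
  moreover have "(\<Sum>i\<le>k. \<Delta> i powr - a) \<le> ?B * \<Delta> k powr - a"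
    using Suc by simp
  ultimately show ?case
    by (simp add: algebra_simps)
qed

section \<open>Hoelder smoothness and approximate subgradients\<close>

locale holder_composite =
  fixes S :: "'a::real_inner set" and f :: "'a \<Rightarrow> real" and h :: "'a \<Rightarrow> ereal" and \<nu> L :: real
  assumes S: "subspace S"
    and f_convex: "convex_on S f"
    and f_subdiff: "x \<in> S \<Longrightarrow> subdiff S (\<lambda>u. ereal (f u)) x \<noteq> {}"
    and h_proper: "x \<in> S \<Longrightarrow> h x \<noteq> - \<infinity>"
    and h_convex: "ereal_convex_on S h"
    and \<nu>: "0 \<le> \<nu>" "\<nu> < 1"
    and L: "L > 0"
    and holder: "holder_smooth_on S f \<nu> L"
begin

definition "effective_domain = {x \<in> S. h x \<noteq> \<infinity>}"
text \<open>\<open>real_of_ereal\<close> sends infinity to 0, so \<open>hr\<close> and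
  \<open>F\<close> carry meaning only on \<open>effective_domain\<close>.\<close>

definition "hr x = real_of_ereal (h x)"
definition "F x = f x + hr x"
text \<open>This is \<open>p - 1\<close> for the exponent
  \<open>p = 2 / (1 + \<nu>)\<close>.\<close>

definition "\<alpha> = (1 - \<nu>) / (1 + \<nu>)"

lemma \<alpha>: "0 < \<alpha>" "1 + \<alpha> = 2 / (1 + \<nu>)" "(1 + \<nu>) * \<alpha> = 1 - \<nu>"
  using \<nu> by (auto simp: \<alpha>_def field_simps)

lemma effective_domainD:
  assumes "x \<in> effective_domain"
  shows "x \<in> S" "h x = ereal (hr x)" "composite p h x = ereal (p x + hr x)"
  using assms h_proper[of x]
  by (cases "h x"; simp add: effective_domain_def hr_def composite_def)+

lemma composite_eq_infinity: "x \<in> S \<Longrightarrow> x \<notin> effective_domain \<Longrightarrow> composite p h x = \<infinity>"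
  by (simp add: effective_domain_def composite_def)

lemma F_segment_le:
  assumes "x \<in> effective_domain" "y \<in> effective_domain" "0 < t" "t \<le> 1"
  shows "x + t *\<^sub>R (y - x) \<in> effective_domain"
    and "F (x + t *\<^sub>R (y - x)) \<le> F x - t * (F x - F y)"
proof -
  note dom = effective_domainD[OF assms(1)] effective_domainD[OF assms(2)]
  have eq: "x + t *\<^sub>R (y - x) = (1 - t) *\<^sub>R x + t *\<^sub>R y"
    by (simp add: algebra_simps)
  have mem: "x + t *\<^sub>R (y - x) \<in> S"
    using S dom by (meson subspace_add subspace_diff subspace_scale)
  \<comment> \<open>\<open>ereal_convex_on\<close> speaks of strictly positive weights, so
    \<open>t = 1\<close> is treated apart.\<close>
  have "h (x + t *\<^sub>R (y - x)) \<le> ereal ((1 - t) * hr x + t * hr y)"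
  proof (cases "t = 1")
    case True
    then show ?thesis
      using dom by simp
  next
    case False
    have "h ((1 - t) *\<^sub>R x + t *\<^sub>R y) \<le> ereal (1 - t) * h x + ereal t * h y"
      using h_convex[unfolded ereal_convex_on_def, THEN conjunct2, rule_format, of x y "1 - t" t]
        False assms dom by simp
    then show ?thesis
      unfolding eq using dom by simp
  qed
  then have h: "h (x + t *\<^sub>R (y - x)) \<noteq> \<infinity>" "h (x + t *\<^sub>R (y - x)) \<le> ereal ((1 - t) * hr x + t * hr y)"
    by auto
  then show "x + t *\<^sub>R (y - x) \<in> effective_domain"
    using mem by (simp add: effective_domain_def)
  then have "hr (x + t *\<^sub>R (y - x)) \<le> (1 - t) * hr x + t * hr y"
    using h effective_domainD(2) by simp
  moreover have "f (x + t *\<^sub>R (y - x)) \<le> (1 - t) * f x + t * f y"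
    unfolding eq using f_convex assms dom by (auto simp: convex_on_def)
  ultimately show "F (x + t *\<^sub>R (y - x)) \<le> F x - t * (F x - F y)"
    by (simp add: F_def algebra_simps)
qed

text \<open>The subgradient inequality at \<open>x\<close> replaces the usual integration along the
  segment; the price is the constant \<open>L\<close> instead of
  \<open>L / (1 + \<nu>)\<close>.\<close>

lemma holder_upper_bound:
  assumes "x \<in> S" "z \<in> S" "g \<in> subdiff S (\<lambda>u. ereal (f u)) z"
  shows "f x \<le> f z + inner g (x - z) + L * norm (x - z) powr (1 + \<nu>)"
proof -
  obtain g' where g': "g' \<in> subdiff S (\<lambda>u. ereal (f u)) x"
    using f_subdiff assms by blast
  then have "f x + inner g' (z - x) \<le> f z"
    using assms by (simp add: subdiff_ereal_iff)
  then have "f x \<le> f z + inner g (x - z) + inner (g' - g) (x - z)"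
    by (simp add: inner_diff_left inner_diff_right)
  also have "inner (g' - g) (x - z) \<le> norm (g' - g) * norm (x - z)"
    by (rule norm_cauchy_schwarz)
  also have "\<dots> \<le> (if \<nu> = 0 then L else L * norm (x - z) powr \<nu>) * norm (x - z)"
    using holder assms g' unfolding holder_smooth_on_def by (intro mult_right_mono) auto
  also have "\<dots> = L * norm (x - z) powr (1 + \<nu>)"
    using \<nu> by (auto simp: powr_add)
  finally show ?thesis
    by simp
qed

text \<open>Moving from \<open>z\<close> a distance \<open>t\<close> along \<open>a - g\<close>, the
  two affine functions separate by \<open>t * norm (g - a)\<close>. The lower bound by
  \<open>a\<close> and the Hoelder upper bound by \<open>g\<close> allow at most
  \<open>G + L * t powr (1 + \<nu>)\<close>, which is \<open>2 * G\<close> for the chosen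
  \<open>t\<close>.\<close>

lemma norm_subgradient_diff_le:
  assumes "z \<in> S" and g: "g \<in> subdiff S (\<lambda>u. ereal (f u)) z" and a: "a \<in> S" and G: "0 < G"
    and below: "\<And>x. x \<in> S \<Longrightarrow> f z - G + inner a (x - z) \<le> f x"
  shows "(norm (g - a))\<^sup>2 \<le> 4 * L powr (1 + \<alpha>) * G powr (1 - \<alpha>)"
proof (cases "g = a")
  case True
  then show ?thesis
    by simp
next
  case False
  define N where "N = norm (g - a)"
  \<comment> \<open>the step length that balances the two terms of \<open>G + L * t powr (1 + \<nu>)\<close>\<close>
  define t where "t = (G / L) powr (1 / (1 + \<nu>))"
  define x where "x = z + (t / N) *\<^sub>R (a - g)"
  have N: "N > 0" and t: "t > 0"
    using False G L by (auto simp: N_def t_def)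
  have gS: "g \<in> S"
    using g by (simp add: subdiff_ereal_iff)
  have "x \<in> S"
    using S a gS assms by (simp add: x_def subspace_add subspace_diff subspace_scale)
  have norm: "norm (x - z) = t"
    using N t by (simp add: x_def N_def norm_minus_commute)
  have "t powr (1 + \<nu>) = G / L"
    using \<nu> G L by (simp add: t_def powr_powr)
  then have Lt: "L * norm (x - z) powr (1 + \<nu>) = G"
    using L norm by simp
  have "inner (a - g) (x - z) = t * N"
    using N by (simp add: x_def N_def norm_minus_commute power2_eq_square flip: power2_norm_eq_inner)
  moreover have "inner (a - g) (x - z) \<le> 2 * G"
    using below[OF \<open>x \<in> S\<close>] holder_upper_bound[OF \<open>x \<in> S\<close> \<open>z \<in> S\<close> g] Lt
    by (simp add: inner_diff_left)
  ultimately have "(t * N)\<^sup>2 \<le> (2 * G)\<^sup>2"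
    using t N by (intro power_mono) auto
  moreover have "t\<^sup>2 = (G / L) powr (1 + \<alpha>)"
    using t unfolding \<alpha>(2) by (simp add: t_def powr_powr flip: powr_numeral)
  ultimately have "(G / L) powr (1 + \<alpha>) * N\<^sup>2 \<le> 4 * G powr 2"
    using G by (simp add: power_mult_distrib)
  also have "G powr 2 = G powr (1 - \<alpha>) * G powr (1 + \<alpha>)"
    by (simp flip: powr_add)
  finally have "G powr (1 + \<alpha>) * N\<^sup>2 \<le> G powr (1 + \<alpha>) * (4 * L powr (1 + \<alpha>) * G powr (1 - \<alpha>))"
    using L G by (simp add: powr_divide field_simps)
  then show ?thesis
    using G by (simp add: N_def)
qed

section \<open>Progress of a single inner iteration\<close>

text \<open>At \<open>w\<close> the new model dominates any convex combination of the aggregated cut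
  and the new cut. Weight \<open>l\<close> on the new cut gains \<open>l * G\<close>, and moving to
  \<open>w\<close> can win back at most
  \<open>l\<^sup>2 / (2 * \<rho>) * (norm (g - a))\<^sup>2\<close>. The choice of \<open>l\<close>
  makes this at most \<open>l * G / 2\<close>; using \<open>\<gamma>\<close> instead of
  \<open>G\<close> in it ensures \<open>l \<le> 1\<close>.\<close>

lemma prox_value_increase:
  assumes z: "z \<in> effective_domain" and w: "w \<in> effective_domain"
    and g: "g \<in> subdiff S (\<lambda>u. ereal (f u)) z"
    and a: "a \<in> subdiff S (\<lambda>u. ereal (p u)) z" and b: "b \<in> subdiff S h z"
    and ab: "a + b = \<rho> *\<^sub>R (c - z)"
    and p: "\<And>x. x \<in> S \<Longrightarrow> p x \<le> f x"
    and q1: "q w \<ge> f z + inner g (w - z)" and q2: "q w \<ge> p z + inner a (w - z)"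
    and \<rho>: "0 < \<rho>" and \<gamma>: "0 < \<gamma>" "\<gamma> \<le> f z - p z" "\<rho> * \<gamma> powr \<alpha> \<le> 4 * L powr (1 + \<alpha>)"
  shows "p z + hr z + \<rho> / 2 * (norm (z - c))\<^sup>2 + \<rho> / (8 * L powr (1 + \<alpha>)) * \<gamma> powr (1 + \<alpha>)
    \<le> q w + hr w + \<rho> / 2 * (norm (w - c))\<^sup>2"
proof -
  define G where "G = f z - p z"
  define \<Lambda> where "\<Lambda> = L powr (1 + \<alpha>)"
  \<comment> \<open>the weight of the new cut in a convex combination with the aggregated cut\<close>
  define l where "l = \<rho> * \<gamma> powr \<alpha> / (4 * \<Lambda>)"
  note zS = effective_domainD[OF z] and wS = effective_domainD[OF w]
  have \<Lambda>: "\<Lambda> > 0" and G: "G > 0" "\<gamma> \<le> G"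
    using L \<gamma> by (auto simp: \<Lambda>_def G_def)
  have l: "0 \<le> l" "l \<le> 1"
    using \<rho> \<gamma> \<Lambda> by (auto simp: l_def \<Lambda>_def)
  have below: "f z - G + inner a (x - z) \<le> f x" if "x \<in> S" for x
    using a p[OF that] that by (auto simp: subdiff_ereal_iff G_def intro: order_trans)
  have A: "(norm (g - a))\<^sup>2 \<le> 4 * \<Lambda> * G powr (1 - \<alpha>)"
    unfolding \<Lambda>_def using a zS g G below
    by (intro norm_subgradient_diff_le) (auto simp: subdiff_ereal_iff)
  have hw: "hr z + inner b (w - z) \<le> hr w"
    using b zS wS by (auto simp: subdiff_def)
  have "(1 - l) * (p z + inner a (w - z)) + l * (f z + inner g (w - z)) \<le> (1 - l) * q w + l * q w"
    using q1 q2 l by (intro add_mono mult_left_mono) auto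
  then have "p z + inner a (w - z) + l * G + l * inner (g - a) (w - z) \<le> q w"
    by (simp add: G_def inner_diff_left algebra_simps)
  \<comment> \<open>Since \<open>a + b\<close> is minus the gradient of the quadratic term at
    \<open>z\<close>, expanding around \<open>z\<close> leaves only the second-order term.\<close>
  moreover have "\<rho> / 2 * (norm (w - c))\<^sup>2 + inner (a + b) (w - z)
      = \<rho> / 2 * (norm (z - c))\<^sup>2 + \<rho> / 2 * (norm (w - z))\<^sup>2"
    unfolding ab power2_norm_eq_inner
    by (simp add: inner_diff_left inner_diff_right inner_commute algebra_simps)
  ultimately have "p z + hr z + \<rho> / 2 * (norm (z - c))\<^sup>2
      + (l * G + (l * inner (g - a) (w - z) + \<rho> / 2 * (norm (w - z))\<^sup>2))
      \<le> q w + hr w + \<rho> / 2 * (norm (w - c))\<^sup>2"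
    using hw by (simp add: inner_add_left)
  moreover have norm_add_sq: "(norm (k *\<^sub>R u + v))\<^sup>2 = k\<^sup>2 * (norm u)\<^sup>2 + 2 * k * inner u v + (norm v)\<^sup>2"
    for k and u v :: 'a
    unfolding power2_norm_eq_inner
    by (simp add: inner_add_left inner_add_right inner_commute power2_eq_square)
  moreover have "\<rho> / (8 * \<Lambda>) * \<gamma> powr (1 + \<alpha>)
      \<le> l * G + (l * inner (g - a) (w - z) + \<rho> / 2 * (norm (w - z))\<^sup>2)"
  proof -
    \<comment> \<open>Completing the square bounds the part that depends on \<open>w\<close>,
      uniformly in \<open>w\<close>.\<close>
    have "0 \<le> (norm ((l / \<rho>) *\<^sub>R (g - a) + (w - z)))\<^sup>2"
      by simp
    also have "\<dots> = (l / \<rho>)\<^sup>2 * (norm (g - a))\<^sup>2 + 2 * (l / \<rho>) * inner (g - a) (w - z) + (norm (w - z))\<^sup>2"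
      by (rule norm_add_sq)
    finally have "0 \<le> \<rho> / 2 * \<dots>"
      using \<rho> by simp
    also have "\<dots> = l\<^sup>2 / (2 * \<rho>) * (norm (g - a))\<^sup>2 + (l * inner (g - a) (w - z) + \<rho> / 2 * (norm (w - z))\<^sup>2)"
      using \<rho> by (simp add: field_simps power2_eq_square)
    also have "l\<^sup>2 / (2 * \<rho>) * (norm (g - a))\<^sup>2 \<le> l\<^sup>2 / (2 * \<rho>) * (4 * \<Lambda> * G powr (1 - \<alpha>))"
      using A \<rho> by (intro mult_left_mono) auto
    also have "\<dots> = l * (\<gamma> powr \<alpha> * G powr (1 - \<alpha>)) / 2"
      using \<rho> \<Lambda> by (simp add: l_def power2_eq_square)
    also have "\<dots> \<le> l * (G powr \<alpha> * G powr (1 - \<alpha>)) / 2"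
      using l \<gamma> G \<alpha> by (intro divide_right_mono mult_left_mono mult_right_mono powr_mono2) auto
    also have "G powr \<alpha> * G powr (1 - \<alpha>) = G"
      using G by (simp flip: powr_add)
    finally have "l * G / 2 \<le> l * G + (l * inner (g - a) (w - z) + \<rho> / 2 * (norm (w - z))\<^sup>2)"
      by linarith
    moreover have "\<rho> / (8 * \<Lambda>) * \<gamma> powr (1 + \<alpha>) = l * \<gamma> / 2"
      using \<gamma> \<Lambda> by (simp add: l_def powr_add)
    moreover have "l * \<gamma> / 2 \<le> l * G / 2"
      using l G by (simp add: mult_left_mono)
    ultimately show ?thesis
      by linarith
  qed
  ultimately show ?thesis
    by (simp add: \<Lambda>_def)
qed

text \<open>The first model contains a cut at the center, so its gap is at most
  \<open>L * r powr (1 + \<nu>)\<close>, and it remains to bound the step length \<open>r\<close>.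
  Optimality bounds \<open>r\<^sup>2\<close> by a sum of two terms: if \<open>\<Delta>\<close>
  dominates, \<open>small\<close> closes the case; otherwise the Hoelder term bounds
  \<open>r\<close> by itself.\<close>

lemma initial_model_gap:
  assumes c: "c \<in> effective_domain" and z: "z \<in> effective_domain"
    and g: "g \<in> subdiff S (\<lambda>u. ereal (f u)) c"
    and p: "p c \<le> f c" "p z \<ge> f c + inner g (z - c)"
    and z_le: "p z + hr z + \<rho> / 2 * (norm (z - c))\<^sup>2 \<le> p c + hr c"
    and \<Delta>: "F c - F z \<le> \<Delta>" "0 \<le> \<Delta>" and \<rho>: "0 < \<rho>"
    and small: "\<rho> * (4 * \<Delta> / \<rho>) powr ((1 - \<nu>) / 2) \<le> 4 * L"
    and G: "0 \<le> G" "G \<le> f z - p z"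
  shows "\<rho> * G powr \<alpha> \<le> 4 * L powr (1 + \<alpha>)"
proof -
  define r where "r = norm (z - c)"
  have r: "r \<ge> 0"
    by (simp add: r_def)
  have gap: "f z - p z \<le> L * r powr (1 + \<nu>)"
    using holder_upper_bound[of z c g] effective_domainD(1)[OF c] effective_domainD(1)[OF z] g p
    by (simp add: r_def)
  \<comment> \<open>\<open>z_le\<close> with the model value at \<open>z\<close> written as
    \<open>f z\<close> minus the gap, and the model value at \<open>c\<close> bounded by
    \<open>f c\<close>.\<close>
  have *: "\<rho> / 2 * r\<^sup>2 \<le> \<Delta> + L * r powr (1 + \<nu>)"
    using gap z_le p \<Delta> by (simp add: F_def r_def)
  have "\<rho> * r powr (1 - \<nu>) \<le> 4 * L"
  proof (cases "L * r powr (1 + \<nu>) \<le> \<Delta>")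
    case True
    then have "r\<^sup>2 \<le> 4 * \<Delta> / \<rho>"
      using * \<rho> by (simp add: field_simps)
    then have "(r\<^sup>2) powr ((1 - \<nu>) / 2) \<le> (4 * \<Delta> / \<rho>) powr ((1 - \<nu>) / 2)"
      using \<nu> by (intro powr_mono2) auto
    moreover have "(r\<^sup>2) powr ((1 - \<nu>) / 2) = r powr (1 - \<nu>)"
      using r \<nu> powr_powr[of r 2 "(1 - \<nu>) / 2"] by (simp add: diff_divide_distrib)
    ultimately have "\<rho> * r powr (1 - \<nu>) \<le> \<rho> * (4 * \<Delta> / \<rho>) powr ((1 - \<nu>) / 2)"
      using \<rho> by simp
    then show ?thesis
      using small by simp
  next
    case False
    then have "\<rho> * r\<^sup>2 \<le> 4 * L * r powr (1 + \<nu>)"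
      using * by simp
    moreover have "r > 0"
      using False \<Delta> r by (cases "r = 0") auto
    moreover from this have "r\<^sup>2 = r powr (1 - \<nu>) * r powr (1 + \<nu>)"
      by (simp flip: powr_add)
    ultimately show ?thesis
      by (simp flip: mult.assoc)
  qed
  then have "L powr \<alpha> * (\<rho> * r powr (1 - \<nu>)) \<le> L powr \<alpha> * (4 * L)"
    by (rule mult_left_mono) simp
  moreover have "(L * r powr (1 + \<nu>)) powr \<alpha> = L powr \<alpha> * r powr (1 - \<nu>)"
    using L r \<alpha>(3) by (simp add: powr_mult powr_powr)
  moreover have "G powr \<alpha> \<le> (L * r powr (1 + \<nu>)) powr \<alpha>"
    using G gap \<alpha> by (intro powr_mono2) auto
  then have "\<rho> * G powr \<alpha> \<le> \<rho> * (L * r powr (1 + \<nu>)) powr \<alpha>"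
    using \<rho> by (intro mult_left_mono) auto
  ultimately have "\<rho> * G powr \<alpha> \<le> L powr \<alpha> * (4 * L)"
    by (simp add: mult.left_commute)
  then show ?thesis
    using L by (simp add: powr_add mult_ac)
qed

section \<open>Complete inner runs\<close>

text \<open>
  \<open>R\<close> bounds the distance to a minimiser and \<open>t\<close> is a step towards it: it shows that the proximal
  subproblem has decrease at least \<open>t / 2 * \<Delta>\<close>.
\<close>

lemma prox_bundle_run_bound:
  assumes run: "prox_bundle_run S f h \<rho> c (descent_test f h \<beta> c) J m z"
    and c: "c \<in> effective_domain" and xs: "xs \<in> effective_domain"
    and min: "\<And>x. x \<in> effective_domain \<Longrightarrow> F xs \<le> F x"
    and \<Delta>: "\<Delta> = F c - F xs" "0 < \<Delta>"
    and R: "norm (xs - c) \<le> R" and t: "0 < t" "t \<le> 1" "t * \<rho> * R\<^sup>2 \<le> \<Delta>"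
    and \<beta>: "0 < \<beta>" "\<beta> < 1" and \<rho>: "0 < \<rho>"
    and small: "\<rho> * (4 * \<Delta> / \<rho>) powr ((1 - \<nu>) / 2) \<le> 4 * L" "\<rho> * \<Delta> powr \<alpha> \<le> 4 * L powr (1 + \<alpha>)"
  shows "\<exists>r. J = enat r \<and> z r \<in> effective_domain \<and> F (z r) \<le> F c - \<beta> * (t / 2 * \<Delta>) \<and>
    real r \<le> (2 + 1 / \<alpha>) * (8 * L powr (1 + \<alpha>) / (\<rho> * ((1 - \<beta>) * (t / 2 * \<Delta>)) powr \<alpha>))"
proof -
  define \<eta> where "\<eta> = (1 - \<beta>) * (t / 2 * \<Delta>)"
  define \<Lambda> where "\<Lambda> = L powr (1 + \<alpha>)"
  define K where "K = \<rho> / (8 * \<Lambda>)"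
  define \<phi> where "\<phi> j = m j (z (Suc j)) + hr (z (Suc j)) + \<rho> / 2 * (norm (z (Suc j) - c))\<^sup>2" for j
  \<comment> \<open>The Moreau envelope of \<open>F\<close> at \<open>c\<close>, taken as an infimum
    so that no proximal point has to be exhibited. \<open>M - \<phi> j\<close> is the envelope gap
    driving the recursion.\<close>
  define M where "M = (INF x\<in>effective_domain. F x + \<rho> / 2 * (norm (x - c))\<^sup>2)"
  have "(1 - \<beta>) * (t / 2) \<le> 1 * 1"
    using \<beta> t by (intro mult_mono) auto
  then have "((1 - \<beta>) * (t / 2)) * \<Delta> \<le> 1 * \<Delta>"
    using \<Delta> by (intro mult_right_mono) auto
  then have \<eta>: "0 < \<eta>" "\<eta> \<le> \<Delta>"
    using \<beta> t \<Delta> by (auto simp: \<eta>_def mult.assoc)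
  have \<Lambda>: "0 < \<Lambda>" and K: "0 < K"
    using L \<rho> by (auto simp: \<Lambda>_def K_def)
  have z0: "z 0 = c" and J: "J \<ge> 1"
    using run by (auto simp: prox_bundle_run_def)
  have adm: "admissible_model S f h \<rho> c m z j"
    and arg_min: "is_arg_min (\<lambda>x. composite (m j) h x + ereal (\<rho> / 2 * (norm (x - c))\<^sup>2)) (\<lambda>x. x \<in> S) (z (Suc j))"
    and test: "descent_test f h \<beta> c (m j) (z (Suc j)) \<longleftrightarrow> enat (Suc j) = J"
    if "enat j < J" for j
    using run that unfolding prox_bundle_run_def by blast+
  have zS: "z (Suc j) \<in> effective_domain" if "enat j < J" for j
  proof -
    have "z (Suc j) \<in> S"
      using arg_min[OF that] by (simp add: is_arg_min_def)
    moreover have "composite (m j) h (z (Suc j)) \<noteq> \<infinity>"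
    proof
      assume "composite (m j) h (z (Suc j)) = \<infinity>"
      moreover have "composite (m j) h c + ereal (\<rho> / 2 * (norm (c - c))\<^sup>2) < \<infinity>"
        using effective_domainD(3)[OF c] by simp
      ultimately show False
        using arg_min[OF that] effective_domainD(1)[OF c] by (auto simp: is_arg_min_def)
    qed
    ultimately show ?thesis
      using composite_eq_infinity by blast
  qed
  have \<phi>_le: "\<phi> j \<le> m j x + hr x + \<rho> / 2 * (norm (x - c))\<^sup>2" if "enat j < J" "x \<in> effective_domain" for j x
    using arg_min[OF that(1)] effective_domainD[OF that(2)] effective_domainD(3)[OF zS[OF that(1)]]
    by (auto simp: is_arg_min_def \<phi>_def not_less)
  have m_le: "m j x \<le> f x" if "enat j < J" "x \<in> S" for j x
    using adm[OF that(1)] that by (simp add: admissible_model_def)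
  have \<phi>_le_M: "\<phi> j \<le> M" if "enat j < J" for j
    unfolding M_def
  proof (rule cINF_greatest)
    show "effective_domain \<noteq> {}"
      using c by blast
    show "\<phi> j \<le> F x + \<rho> / 2 * (norm (x - c))\<^sup>2" if "x \<in> effective_domain" for x
      using \<phi>_le[OF \<open>enat j < J\<close> that] m_le[OF \<open>enat j < J\<close>] effective_domainD(1)[OF that]
      by (simp add: F_def add_mono order_trans)
  qed
  have M_le: "M \<le> F x + \<rho> / 2 * (norm (x - c))\<^sup>2" if "x \<in> effective_domain" for x
    unfolding M_def
  proof (rule cINF_lower)
    show "bdd_below ((\<lambda>x. F x + \<rho> / 2 * (norm (x - c))\<^sup>2) ` effective_domain)"
      using min \<rho> by (intro bdd_belowI2[of _ "F xs"]) (simp add: add_increasing2)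
  qed (rule that)
  \<comment> \<open>Convexity gives a decrease of \<open>t * \<Delta>\<close> at the trial point,
    and the quadratic term costs at most half of it.\<close>
  have M_gap: "t / 2 * \<Delta> \<le> F c - M"
  proof -
    have "M \<le> F c - t * \<Delta> + \<rho> / 2 * (norm (c + t *\<^sub>R (xs - c) - c))\<^sup>2"
      using M_le[OF F_segment_le(1)[OF c xs t(1,2)]] F_segment_le(2)[OF c xs t(1,2)] \<Delta> by simp
    also have "\<rho> / 2 * (norm (c + t *\<^sub>R (xs - c) - c))\<^sup>2 = t / 2 * (t * \<rho> * (norm (xs - c))\<^sup>2)"
      by (simp add: power_mult_distrib power2_eq_square)
    also have "\<dots> \<le> t / 2 * (t * \<rho> * R\<^sup>2)"
      using R t \<rho> by (intro mult_left_mono power_mono) auto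
    also have "\<dots> \<le> t / 2 * \<Delta>"
      using t by (intro mult_left_mono) auto
    finally show ?thesis
      by (simp add: algebra_simps)
  qed
  \<comment> \<open>\<open>enat (Suc j) < J\<close> says that iteration \<open>j\<close> was a null
    step. The failed test yields the bound by \<open>\<eta>\<close>; the bound by
    \<open>M - \<phi> j\<close> holds because \<open>z (Suc j)\<close> itself competes in the
    infimum \<open>M\<close>.\<close>
  have gap: "max (M - \<phi> j) \<eta> \<le> f (z (Suc j)) - m j (z (Suc j))" if "enat (Suc j) < J" for j
  proof -
    have j: "enat j < J"
      using that by (meson enat_ord_simps(2) lessI less_trans)
    note w = zS[OF j]
    have "\<not> descent_test f h \<beta> c (m j) (z (Suc j))"
      using test[OF j] that by simp
    then have "F c - F (z (Suc j)) < \<beta> * (F c - (m j (z (Suc j)) + hr (z (Suc j))))"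
      by (simp add: descent_test_def effective_domainD(3)[OF c] effective_domainD(3)[OF w] F_def)
    then have "(1 - \<beta>) * (F c - (m j (z (Suc j)) + hr (z (Suc j)))) \<le> f (z (Suc j)) - m j (z (Suc j))"
      by (simp add: F_def algebra_simps)
    moreover have "t / 2 * \<Delta> \<le> F c - (m j (z (Suc j)) + hr (z (Suc j)))"
    proof -
      have "m j (z (Suc j)) + hr (z (Suc j)) \<le> \<phi> j"
        using \<rho> by (simp add: \<phi>_def)
      then show ?thesis
        using \<phi>_le_M[OF j] M_gap by linarith
    qed
    then have "\<eta> \<le> (1 - \<beta>) * (F c - (m j (z (Suc j)) + hr (z (Suc j))))"
      unfolding \<eta>_def using \<beta> by (intro mult_left_mono) auto
    moreover have "M - \<phi> j \<le> f (z (Suc j)) - m j (z (Suc j))"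
      using M_le[OF w] by (simp add: \<phi>_def F_def)
    ultimately show ?thesis
      by simp
  qed
  have \<eta>_small: "\<rho> * \<eta> powr \<alpha> \<le> 4 * \<Lambda>"
  proof -
    have "\<rho> * \<eta> powr \<alpha> \<le> \<rho> * \<Delta> powr \<alpha>"
      using \<rho> \<eta> \<alpha> by (intro mult_left_mono powr_mono2) auto
    then show ?thesis
      using small by (simp add: \<Lambda>_def)
  qed
  have increase: "\<phi> j + K * max (M - \<phi> j) \<eta> powr (1 + \<alpha>) \<le> \<phi> (Suc j)"
    if J: "enat (Suc j) < J" and small: "\<rho> * max (M - \<phi> j) \<eta> powr \<alpha> \<le> 4 * \<Lambda>" for j
  proof -
    have j: "enat j < J"
      using J by (meson enat_ord_simps(2) lessI less_trans)
    from adm[OF J] obtain g a b where ab: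
      "g \<in> subdiff S (\<lambda>u. ereal (f u)) (z (Suc j))"
      "\<And>x. x \<in> S \<Longrightarrow> m (Suc j) x \<ge> f (z (Suc j)) + inner g (x - z (Suc j))"
      "a \<in> subdiff S (\<lambda>u. ereal (m j u)) (z (Suc j))" "b \<in> subdiff S h (z (Suc j))"
      "a + b = \<rho> *\<^sub>R (c - z (Suc j))"
      "\<And>x. x \<in> S \<Longrightarrow> m (Suc j) x \<ge> m j (z (Suc j)) + inner a (x - z (Suc j))"
      unfolding admissible_model_def by auto
    note w = effective_domainD(1)[OF zS[OF J]]
    show ?thesis
      unfolding \<phi>_def[of "Suc j"]
      using prox_value_increase[where p = "m j" and q = "m (Suc j)", OF zS[OF j] zS[OF J] ab(1,3-5) m_le[OF j] ab(2)[OF w] ab(6)[OF w] \<rho>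
          _ gap[OF J] small[unfolded \<Lambda>_def]] \<eta>
      by (simp add: \<phi>_def[of j] K_def \<Lambda>_def)
  qed
  \<comment> \<open>Only the first iteration needs \<open>initial_model_gap\<close>: afterwards
    \<open>increase\<close> makes \<open>max (M - \<phi> j) \<eta>\<close> nonincreasing, so the
    condition is inherited.\<close>
  have e_small: "\<rho> * max (M - \<phi> j) \<eta> powr \<alpha> \<le> 4 * \<Lambda>" if "enat j < J" for j
    using that
  proof (induction j)
    case 0
    from adm[OF 0] obtain g where g: "g \<in> subdiff S (\<lambda>u. ereal (f u)) c"
      "\<And>x. x \<in> S \<Longrightarrow> m 0 x \<ge> f c + inner g (x - c)"
      unfolding admissible_model_def z0 by blast
    have "\<rho> * (M - \<phi> 0) powr \<alpha> \<le> 4 * L powr (1 + \<alpha>)"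
    proof (rule initial_model_gap[OF c zS[OF 0] g(1) _ _ _ _ _ \<rho> small(1)])
      show "m 0 c \<le> f c" "f c + inner g (z (Suc 0) - c) \<le> m 0 (z (Suc 0))"
        using m_le[OF 0] g(2) effective_domainD(1)[OF c] effective_domainD(1)[OF zS[OF 0]] by auto
      show "m 0 (z (Suc 0)) + hr (z (Suc 0)) + \<rho> / 2 * (norm (z (Suc 0) - c))\<^sup>2 \<le> m 0 c + hr c"
        using \<phi>_le[OF 0 c] by (simp add: \<phi>_def)
      show "F c - F (z (Suc 0)) \<le> \<Delta>" "0 \<le> \<Delta>"
        using min[OF zS[OF 0]] \<Delta> by auto
      show "0 \<le> M - \<phi> 0" "M - \<phi> 0 \<le> f (z (Suc 0)) - m 0 (z (Suc 0))"
        using \<phi>_le_M[OF 0] M_le[OF zS[OF 0]] by (auto simp: \<phi>_def F_def)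
    qed
    then show ?case
      using \<eta>_small by (simp add: max_def \<Lambda>_def)
  next
    case (Suc j)
    have j: "enat j < J"
      using Suc.prems by (meson enat_ord_simps(2) lessI less_trans)
    have "0 \<le> K * max (M - \<phi> j) \<eta> powr (1 + \<alpha>)"
      using K by simp
    then have "max (M - \<phi> (Suc j)) \<eta> \<le> max (M - \<phi> j) \<eta>"
      using increase[OF Suc.prems Suc.IH[OF j]] by linarith
    then have "\<rho> * max (M - \<phi> (Suc j)) \<eta> powr \<alpha> \<le> \<rho> * max (M - \<phi> j) \<eta> powr \<alpha>"
      using \<rho> \<eta> \<alpha> by (intro mult_left_mono powr_mono2) auto
    then show ?case
      using Suc.IH[OF j] by linarith
  qed
  have count: "T \<le> (1 + 1 / \<alpha>) / (K * \<eta> powr \<alpha>)" if T: "enat T < J" for T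
  proof (rule power_decrease_step_count[of _ _ _ _ "\<lambda>j. M - \<phi> j"])
    show "0 \<le> M - \<phi> j" if "j \<le> T" for j
      using \<phi>_le_M[of j] that T by (metis diff_ge_0_iff_ge enat_ord_simps(1) le_less_trans)
    show "M - \<phi> (Suc j) \<le> M - \<phi> j - K * max (M - \<phi> j) \<eta> powr (1 + \<alpha>)" if "j < T" for j
    proof -
      have "enat (Suc j) < J" "enat j < J"
        using that T by (metis Suc_leI enat_ord_simps(1) le_less_trans, metis enat_ord_simps(2) less_trans)
      then show ?thesis
        using increase[OF _ e_small] by fastforce
    qed
  qed (use \<alpha> K \<eta> in auto)
  \<comment> \<open>In an infinite run every \<open>T\<close> would satisfy the bound
    \<open>count\<close>, whose right-hand side is fixed.\<close>
  have "J \<noteq> \<infinity>"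
  proof
    assume "J = \<infinity>"
    moreover obtain T :: nat where "(1 + 1 / \<alpha>) / (K * \<eta> powr \<alpha>) < T"
      using reals_Archimedean2 by blast
    ultimately show False
      using count[of T] by simp
  qed
  then obtain r where r: "J = enat r"
    by auto
  then obtain T where T: "r = Suc T"
    using J by (cases r) (auto simp: zero_enat_def one_enat_def)
  have TJ: "enat T < J"
    using r T by simp
  note w = zS[OF TJ]
  have "descent_test f h \<beta> c (m T) (z (Suc T))"
    using test[OF TJ] r T by simp
  then have "F c - F (z (Suc T)) \<ge> \<beta> * (F c - (m T (z (Suc T)) + hr (z (Suc T))))"
    by (simp add: descent_test_def effective_domainD(3)[OF c] effective_domainD(3)[OF w] F_def)
  moreover have "m T (z (Suc T)) + hr (z (Suc T)) \<le> \<phi> T"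
    using \<rho> by (simp add: \<phi>_def)
  then have "\<beta> * (t / 2 * \<Delta>) \<le> \<beta> * (F c - (m T (z (Suc T)) + hr (z (Suc T))))"
    using \<beta> \<phi>_le_M[OF TJ] M_gap by (intro mult_left_mono) auto
  ultimately have descent: "F (z r) \<le> F c - \<beta> * (t / 2 * \<Delta>)"
    by (simp add: T)
  \<comment> \<open>\<open>count\<close> covers the null steps only. This inequality absorbs the
    final descent step and turns \<open>1 + 1 / \<alpha>\<close> into
    \<open>2 + 1 / \<alpha>\<close>.\<close>
  have "K * \<eta> powr \<alpha> \<le> 1"
    using \<eta>_small \<Lambda> by (simp add: K_def field_simps)
  then have "1 \<le> 1 / (K * \<eta> powr \<alpha>)"
    using K \<eta> by simp
  then have "real r \<le> (1 + 1 / \<alpha>) / (K * \<eta> powr \<alpha>) + 1 / (K * \<eta> powr \<alpha>)"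
    using count[OF TJ] by (simp add: T)
  also have "\<dots> = (2 + 1 / \<alpha>) * (1 / (K * \<eta> powr \<alpha>))"
    by (simp add: add_divide_distrib algebra_simps)
  also have "1 / (K * \<eta> powr \<alpha>) = 8 * \<Lambda> / (\<rho> * \<eta> powr \<alpha>)"
    by (simp add: K_def)
  finally show ?thesis
    using r w descent by (auto simp: \<Lambda>_def \<eta>_def T)
qed

section \<open>The outer loop\<close>

text \<open>While the gap exceeds \<open>\<epsilon>\<close>, the inner bound applies with the
  current gap: \<open>t * \<rho> * R\<^sup>2 \<le> \<epsilon>\<close> suffices for each of them, and
  both conditions in \<open>small\<close> are monotone in the gap. The minimiser supplied by
  \<open>near\<close> may change from one center to the next.\<close>

lemma pbm_run_bound:
  assumes run: "pbm_run S f h \<rho> \<beta> y0 y J m z"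
    and y0: "y0 \<in> effective_domain"
    and min: "\<And>x. x \<in> effective_domain \<Longrightarrow> Fs \<le> F x"
    and near: "\<And>x. x \<in> effective_domain \<Longrightarrow> F x \<le> F y0 \<Longrightarrow>
      \<exists>xs\<in>effective_domain. F xs = Fs \<and> norm (xs - x) \<le> R"
    and \<epsilon>: "0 < \<epsilon>" "\<epsilon> < F y0 - Fs"
    and t: "0 < t" "t \<le> 1" "t * \<rho> * R\<^sup>2 \<le> \<epsilon>"
    and \<beta>: "0 < \<beta>" "\<beta> < 1" and \<rho>: "0 < \<rho>"
    and small: "\<rho> * (4 * (F y0 - Fs) / \<rho>) powr ((1 - \<nu>) / 2) \<le> 4 * L"
      "\<rho> * (F y0 - Fs) powr \<alpha> \<le> 4 * L powr (1 + \<alpha>)"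
  shows "\<exists>k N. y k \<in> effective_domain \<and> F (y k) - Fs \<le> \<epsilon> \<and> (\<Sum>i<k. J i) = enat N \<and>
    real N \<le> (2 + 1 / \<alpha>) * (8 * L powr (1 + \<alpha>) / (\<rho> * ((1 - \<beta>) * (t / 2)) powr \<alpha>)) *
      ((1 + 1 / (\<alpha> * (\<beta> * (t / 2)))) * \<epsilon> powr - \<alpha>)"
proof -
  define q where "q = \<beta> * (t / 2)"
  define W where "W = (2 + 1 / \<alpha>) * (8 * L powr (1 + \<alpha>) / (\<rho> * ((1 - \<beta>) * (t / 2)) powr \<alpha>))"
  define \<Delta> where "\<Delta> k = F (y k) - Fs" for k
  \<comment> \<open>The invariant includes finiteness of all earlier inner runs, since
    \<open>pbm_run\<close> constrains the data of index \<open>k\<close> only in that case. It also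
    includes that no earlier gap is at most \<open>\<epsilon>\<close>, so a good \<open>k\<close>
    with \<open>\<Delta> k \<le> \<epsilon>\<close> is the first such index.\<close>
  define good where "good k \<longleftrightarrow> y k \<in> effective_domain \<and> F (y k) \<le> F y0 \<and>
    (\<forall>i<k. \<epsilon> < \<Delta> i \<and> \<Delta> (Suc i) \<le> (1 - q) * \<Delta> i \<and> (\<exists>r. J i = enat r \<and> real r \<le> W * \<Delta> i powr - \<alpha>))" for k
  have "\<beta> * (t / 2) \<le> 1 * (1 / 2)"
    using \<beta> t by (intro mult_mono) auto
  then have q: "0 < q" "q < 1"
    using \<beta> t by (auto simp: q_def)
  have W: "0 \<le> W"
    using \<alpha> \<rho> by (simp add: W_def)
  have y_0: "y 0 = y0"
    using run by (simp add: pbm_run_def)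
  have good_Suc: "good (Suc k)" if good: "good k" and large: "\<epsilon> < \<Delta> k" for k
  proof -
    have dom: "y k \<in> effective_domain" "F (y k) \<le> F y0"
      using good by (auto simp: good_def)
    obtain xs where xs: "xs \<in> effective_domain" "F xs = Fs" "norm (xs - y k) \<le> R"
      using near[OF dom] by blast
    have "\<forall>i<k. J i \<noteq> \<infinity>"
      using good by (auto simp: good_def)
    then have run_k: "prox_bundle_run S f h \<rho> (y k) (descent_test f h \<beta> (y k)) (J k) (m k) (z k)"
      and out: "\<And>r. J k = enat r \<Longrightarrow> y (Suc k) = z k r"
      using run by (auto simp: pbm_run_def)
    have \<Delta>_le: "\<Delta> k \<le> F y0 - Fs"
      using dom by (simp add: \<Delta>_def)
    have "(4 * \<Delta> k / \<rho>) powr ((1 - \<nu>) / 2) \<le> (4 * (F y0 - Fs) / \<rho>) powr ((1 - \<nu>) / 2)"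
      using \<Delta>_le \<rho> \<nu> \<epsilon> large by (intro powr_mono2 divide_right_mono) auto
    then have "\<rho> * (4 * \<Delta> k / \<rho>) powr ((1 - \<nu>) / 2) \<le> \<rho> * (4 * (F y0 - Fs) / \<rho>) powr ((1 - \<nu>) / 2)"
      using \<rho> by (intro mult_left_mono) auto
    then have small1: "\<rho> * (4 * \<Delta> k / \<rho>) powr ((1 - \<nu>) / 2) \<le> 4 * L"
      using small(1) by linarith
    have "\<rho> * \<Delta> k powr \<alpha> \<le> \<rho> * (F y0 - Fs) powr \<alpha>"
      using \<Delta>_le \<rho> \<alpha> \<epsilon> large by (intro mult_left_mono powr_mono2) auto
    then have small2: "\<rho> * \<Delta> k powr \<alpha> \<le> 4 * L powr (1 + \<alpha>)"
      using small(2) by linarith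
    have "\<exists>r. J k = enat r \<and> z k r \<in> effective_domain \<and> F (z k r) \<le> F (y k) - \<beta> * (t / 2 * \<Delta> k) \<and>
      real r \<le> (2 + 1 / \<alpha>) * (8 * L powr (1 + \<alpha>) / (\<rho> * ((1 - \<beta>) * (t / 2 * \<Delta> k)) powr \<alpha>))"
      using xs t \<epsilon> large min
      by (intro prox_bundle_run_bound[OF run_k dom(1) xs(1) _ _ _ xs(3) t(1,2) _ \<beta> \<rho> small1 small2])
        (auto simp: \<Delta>_def)
    then obtain r where r: "J k = enat r" "z k r \<in> effective_domain"
      "F (z k r) \<le> F (y k) - \<beta> * (t / 2 * \<Delta> k)"
      "real r \<le> (2 + 1 / \<alpha>) * (8 * L powr (1 + \<alpha>) / (\<rho> * ((1 - \<beta>) * (t / 2 * \<Delta> k)) powr \<alpha>))"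
      by blast
    have pos: "0 < \<Delta> k"
      using \<epsilon> large by simp
    have powr_eq: "((1 - \<beta>) * (t / 2 * \<Delta> k)) powr \<alpha> = ((1 - \<beta>) * (t / 2)) powr \<alpha> * \<Delta> k powr \<alpha>"
      unfolding mult.assoc[symmetric, of "1 - \<beta>"] by (rule powr_mult)
    have "real r \<le> W * \<Delta> k powr - \<alpha>"
      using r(4) unfolding powr_eq
      by (simp only: W_def powr_minus divide_inverse inverse_mult_distrib mult_ac)
    moreover have "\<Delta> (Suc k) \<le> (1 - q) * \<Delta> k"
      using r(3) out[OF r(1)] by (simp add: \<Delta>_def q_def left_diff_distrib mult.assoc)
    moreover have "0 \<le> \<beta> * (t / 2 * \<Delta> k)"
      using \<beta> t pos by simp
    then have "F (y (Suc k)) \<le> F y0"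
      using r(3) out[OF r(1)] dom by simp
    ultimately show ?thesis
      using good large r(1,2) out[OF r(1)] by (auto simp: good_def less_Suc_eq)
  qed
  \<comment> \<open>Otherwise \<open>good_Suc\<close> could be iterated forever, and the gaps would
    tend to 0 geometrically while staying above \<open>\<epsilon>\<close>.\<close>
  have "\<exists>k. good k \<and> \<Delta> k \<le> \<epsilon>"
  proof (rule ccontr)
    assume contr: "\<not> ?thesis"
    have all: "good k" for k
    proof (induction k)
      case 0
      then show ?case
        using y0 y_0 by (simp add: good_def)
    next
      case (Suc k)
      then show ?case
        using contr by (intro good_Suc) (auto simp: not_le)
    qed
    have "\<Delta> k \<le> (1 - q) ^ k * \<Delta> 0" for k
    proof (induction k)
      case (Suc k)
      have "\<Delta> (Suc k) \<le> (1 - q) * \<Delta> k"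
        using all[of "Suc k"] by (simp add: good_def)
      also have "\<dots> \<le> (1 - q) * ((1 - q) ^ k * \<Delta> 0)"
        using Suc q by (intro mult_left_mono) auto
      finally show ?case
        by (simp add: mult.assoc)
    qed simp
    moreover have "(\<lambda>k. (1 - q) ^ k * \<Delta> 0) \<longlonglongrightarrow> 0"
      using q by (intro tendsto_mult_left_zero LIMSEQ_realpow_zero) auto
    then have "\<forall>\<^sub>F k in sequentially. (1 - q) ^ k * \<Delta> 0 < \<epsilon>"
      using \<epsilon>(1) by (rule order_tendstoD)
    then obtain k where "(1 - q) ^ k * \<Delta> 0 < \<epsilon>"
      by (auto simp: eventually_sequentially)
    ultimately have "\<Delta> k \<le> \<epsilon>"
      by (meson le_less_trans less_imp_le)
    then show False
      using all contr by blast
  qed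
  then obtain k where k: "good k" "\<Delta> k \<le> \<epsilon>"
    by blast
  \<comment> \<open>The initial gap exceeds \<open>\<epsilon>\<close>, so \<open>k\<close> is
    positive. The sum ends at the center \<open>y i\<close>, whose gap is still above
    \<open>\<epsilon>\<close>; this turns its last term into a power of
    \<open>\<epsilon>\<close>.\<close>
  then obtain i where i: "k = Suc i"
    using \<epsilon> y_0 by (cases k) (auto simp: \<Delta>_def)
  have large: "\<epsilon> < \<Delta> l" if "l \<le> i" for l
    using k that by (auto simp: good_def i)
  obtain r where r: "\<And>l. l < k \<Longrightarrow> J l = enat (r l) \<and> real (r l) \<le> W * \<Delta> l powr - \<alpha>"
    using k unfolding good_def by metis
  have "(\<Sum>l<k. J l) = (\<Sum>l<k. enat (r l))"
    using r by simp
  also have "\<dots> = enat (\<Sum>l<k. r l)"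
    by (simp flip: of_nat_eq_enat)
  finally have sum: "(\<Sum>l<k. J l) = enat (\<Sum>l<k. r l)" .
  have "real (\<Sum>l<k. r l) \<le> (\<Sum>l<k. W * \<Delta> l powr - \<alpha>)"
    unfolding of_nat_sum using r by (intro sum_mono) auto
  also have "\<dots> = W * (\<Sum>l\<le>i. \<Delta> l powr - \<alpha>)"
    by (simp add: i sum_distrib_left lessThan_Suc_atMost)
  also have "\<dots> \<le> W * ((1 + 1 / (\<alpha> * q)) * \<Delta> i powr - \<alpha>)"
  proof (intro mult_left_mono W sum_powr_geometric_le)
    show "0 < \<Delta> l" if "l \<le> i" for l
      using large[OF that] \<epsilon> by simp
    show "\<Delta> (Suc l) \<le> (1 - q) * \<Delta> l" if "l < i" for l
      using k that by (simp add: good_def i)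
  qed (use \<alpha> q in auto)
  also have "\<dots> \<le> W * ((1 + 1 / (\<alpha> * q)) * \<epsilon> powr - \<alpha>)"
    using W \<alpha> q \<epsilon> large[of i] by (intro mult_left_mono powr_mono2') auto
  finally show ?thesis
    using k sum unfolding good_def \<Delta>_def W_def q_def by blast
qed

end

section \<open>Choice of constants and the limit of small \<epsilon>\<close>

theorem theorem2:
  fixes \<nu> c :: real
  assumes "0 \<le> \<nu>" "\<nu> < 1" "c > 0"
  shows "\<exists>C>0. \<forall>(n::nat) (f :: rvec \<Rightarrow> real) (h :: rvec \<Rightarrow> ereal) (L::real) (y0 :: rvec) (\<beta>::real) (D::real).
    convex_on (Rn n) f \<and>
    proper_on (Rn n) h \<and> lsc_on (Rn n) h \<and> ereal_convex_on (Rn n) h \<and>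
    solution_set (Rn n) (composite f h) \<noteq> {} \<and>
    L > 0 \<and> holder_smooth_on (Rn n) f \<nu> L \<and>
    y0 \<in> Rn n \<and> composite f h y0 < \<infinity> \<and>
    0 < \<beta> \<and> \<beta> < 1 \<and> D > 0 \<and>
    (\<forall>x\<in>Rn n. composite f h x \<le> composite f h y0 \<longrightarrow>
       infdist x (solution_set (Rn n) (composite f h)) \<le> D) \<longrightarrow>
    (\<forall>\<^sub>F \<epsilon> in at_right 0.
       ereal \<epsilon> < composite f h y0 - min_value (Rn n) (composite f h) \<longrightarrow>
       (\<forall>y J m z. pbm_run (Rn n) f h (c * \<epsilon> / D\<^sup>2) \<beta> y0 y J m z \<longrightarrow>
          (\<exists>k N. composite f h (y k) - min_value (Rn n) (composite f h) \<le> ereal \<epsilon> \<and>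
             (\<Sum>i<k. J i) = enat N \<and>
             real N \<le> C * (L powr (2 / (1 + \<nu>)) * D\<^sup>2 /
               (\<beta> * (1 - \<beta>) powr ((1 - \<nu>) / (1 + \<nu>)) * \<epsilon> powr (2 / (1 + \<nu>)))))))"
proof -
  define a where "a = (1 - \<nu>) / (1 + \<nu>)"
  \<comment> \<open>With \<open>R = 2 * D\<close> and
    \<open>\<rho> = c * \<epsilon> / D\<^sup>2\<close> the requirement
    \<open>t * \<rho> * R\<^sup>2 \<le> \<epsilon>\<close> reads \<open>4 * c * t \<le> 1\<close>.
    Hence \<open>t\<close>, and with it \<open>C\<close>, depends on \<nu> and \<open>c\<close>
    alone.\<close>
  define t where "t = min 1 (1 / (4 * c))"
  define C where "C = 8 * (2 + 1 / a) * (1 + 1 / a) / (c * (t / 2) powr (1 + a))"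
  have a: "0 < a" and a1: "2 / (1 + \<nu>) = 1 + a"
    using assms by (auto simp: a_def field_simps)
  have t: "0 < t" "t \<le> 1" "4 * c * t \<le> 1"
    using assms by (auto simp: t_def min_def field_simps)
  show ?thesis
    unfolding a1 a_def[symmetric]
  proof (intro exI[of _ C] conjI allI impI)
    show "C > 0"
      using a t assms by (auto simp: C_def intro!: divide_pos_pos mult_pos_pos add_pos_pos)
    fix n :: nat and f :: "rvec \<Rightarrow> real" and h :: "rvec \<Rightarrow> ereal" and L :: real and y0 :: rvec and \<beta> D :: real
    let ?X = "solution_set (Rn n) (composite f h)"
    assume *: "convex_on (Rn n) f \<and>
      proper_on (Rn n) h \<and> lsc_on (Rn n) h \<and> ereal_convex_on (Rn n) h \<and> ?X \<noteq> {} \<and>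
      L > 0 \<and> holder_smooth_on (Rn n) f \<nu> L \<and> y0 \<in> Rn n \<and> composite f h y0 < \<infinity> \<and>
      0 < \<beta> \<and> \<beta> < 1 \<and> D > 0 \<and>
      (\<forall>x\<in>Rn n. composite f h x \<le> composite f h y0 \<longrightarrow> infdist x ?X \<le> D)"
    then have \<beta>: "0 < \<beta>" "\<beta> < 1" and D: "D > 0" and L: "L > 0" by auto
    interpret holder_composite "Rn n" f h \<nu> L
      using * assms by unfold_locales (auto simp: subspace_Rn proper_on_def dest: subdiff_Rn_nonempty)
    have \<alpha>_eq: "\<alpha> = a"
      by (simp add: \<alpha>_def a_def)
    have y0: "y0 \<in> effective_domain"
      using * composite_eq_infinity by fastforce
    have solution_dom: "xs \<in> effective_domain" if "xs \<in> ?X" for xs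
    proof -
      have "composite f h xs \<le> composite f h y0"
        using that * unfolding solution_set_def min_value_def by (auto intro: INF_lower)
      then show ?thesis
        using that * composite_eq_infinity unfolding solution_set_def by fastforce
    qed
    from * obtain x0 where x0: "x0 \<in> ?X"
      by blast
    define Fs where "Fs = F x0"
    have F_eq: "composite f h x = ereal (F x)" if "x \<in> effective_domain" for x
      using effective_domainD(3)[OF that] by (simp add: F_def)
    have min_eq: "min_value (Rn n) (composite f h) = ereal Fs"
      using x0 F_eq[OF solution_dom[OF x0]] by (simp add: solution_set_def Fs_def)
    have F_solution: "F xs = Fs" if "xs \<in> ?X" for xs
      using that F_eq[OF solution_dom[OF that]] min_eq by (simp add: solution_set_def)
    have min: "Fs \<le> F x" if "x \<in> effective_domain" for x
    proof -
      have "min_value (Rn n) (composite f h) \<le> composite f h x"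
        unfolding min_value_def using effective_domainD(1)[OF that] by (rule INF_lower)
      then show ?thesis
        by (simp add: min_eq F_eq that)
    qed
    \<comment> \<open>Doubling \<open>D\<close> makes the bound on \<open>infdist\<close> strict,
      which yields an actual minimiser within that distance without a projection onto the solution
      set.\<close>
    have near: "\<exists>xs\<in>effective_domain. F xs = Fs \<and> norm (xs - x) \<le> 2 * D"
      if "x \<in> effective_domain" "F x \<le> F y0" for x
    proof -
      have "infdist x ?X < 2 * D"
        using * D that effective_domainD(1)[OF that(1)] F_eq y0 by fastforce
      then have "(INF xs\<in>?X. dist x xs) < 2 * D"
        using x0 by (subst (asm) infdist_notempty) auto
      then obtain xs where "xs \<in> ?X" "dist x xs < 2 * D"
        using cInf_lessD[of "dist x ` ?X"] x0 by blast
      then show ?thesis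
        using solution_dom F_solution by (intro bexI[of _ xs]) (auto simp: dist_norm norm_minus_commute)
    qed
    define \<Delta> where "\<Delta> = F y0 - Fs"
    have \<Delta>: "0 \<le> \<Delta>"
      using min[OF y0] by (simp add: \<Delta>_def)
    have \<rho>_lim: "((\<lambda>\<epsilon>. c * \<epsilon> / D\<^sup>2) \<longlongrightarrow> 0) (at_right 0)"
      using D by (auto intro!: tendsto_eq_intros)
    have pos: "\<forall>\<^sub>F \<epsilon> in at_right (0::real). 0 < \<epsilon>"
      by (rule eventually_at_right_less)
    have "((\<lambda>\<epsilon>. (c * \<epsilon> / D\<^sup>2) * \<Delta> powr \<alpha>) \<longlongrightarrow> 0) (at_right 0)"
      by (intro tendsto_mult_left_zero \<rho>_lim)
    then have small2: "\<forall>\<^sub>F \<epsilon> in at_right 0. (c * \<epsilon> / D\<^sup>2) * \<Delta> powr \<alpha> < 4 * L powr (1 + \<alpha>)"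
      by (rule order_tendstoD) (use L in simp)
    \<comment> \<open>The first smallness condition with the powers of \<open>\<rho>\<close>
      collected: their exponent is \<open>(1 + \<nu>) / 2 > 0\<close>, so it holds eventually for
      the fixed initial gap.\<close>
    have "((\<lambda>\<epsilon>. (c * \<epsilon> / D\<^sup>2) powr (1 - (1 - \<nu>) / 2)) \<longlongrightarrow> 0) (at_right 0)"
      using assms by (intro tendsto_zero_powrI[OF \<rho>_lim tendsto_const] eventually_mono[OF pos]) auto
    then have "((\<lambda>\<epsilon>. (c * \<epsilon> / D\<^sup>2) powr (1 - (1 - \<nu>) / 2) * (4 * \<Delta>) powr ((1 - \<nu>) / 2)) \<longlongrightarrow> 0) (at_right 0)"
      by (rule tendsto_mult_left_zero)
    then have small1: "\<forall>\<^sub>F \<epsilon> in at_right 0.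
        (c * \<epsilon> / D\<^sup>2) powr (1 - (1 - \<nu>) / 2) * (4 * \<Delta>) powr ((1 - \<nu>) / 2) < 4 * L"
      by (rule order_tendstoD) (use L in simp)
    show "\<forall>\<^sub>F \<epsilon> in at_right 0.
       ereal \<epsilon> < composite f h y0 - min_value (Rn n) (composite f h) \<longrightarrow>
       (\<forall>y J m z. pbm_run (Rn n) f h (c * \<epsilon> / D\<^sup>2) \<beta> y0 y J m z \<longrightarrow>
          (\<exists>k N. composite f h (y k) - min_value (Rn n) (composite f h) \<le> ereal \<epsilon> \<and>
             (\<Sum>i<k. J i) = enat N \<and>
             real N \<le> C * (L powr (1 + a) * D\<^sup>2 / (\<beta> * (1 - \<beta>) powr a * \<epsilon> powr (1 + a)))))"
      using pos small1 small2
    proof eventually_elim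
      case (elim \<epsilon>)
      define \<rho> where "\<rho> = c * \<epsilon> / D\<^sup>2"
      have \<rho>: "0 < \<rho>"
        using elim(1) D assms by (simp add: \<rho>_def)
      have "\<rho> * (4 * \<Delta> / \<rho>) powr ((1 - \<nu>) / 2) = \<rho> powr (1 - (1 - \<nu>) / 2) * (4 * \<Delta>) powr ((1 - \<nu>) / 2)"
        using \<rho> \<Delta> by (simp add: powr_divide powr_diff)
      then have small: "\<rho> * (4 * \<Delta> / \<rho>) powr ((1 - \<nu>) / 2) \<le> 4 * L" "\<rho> * \<Delta> powr \<alpha> \<le> 4 * L powr (1 + \<alpha>)"
        using elim(2,3) by (auto simp: \<rho>_def)
      have "t * \<rho> * (2 * D)\<^sup>2 = (4 * c * t) * \<epsilon>"
        using D by (simp add: \<rho>_def power2_eq_square)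
      also have "\<dots> \<le> 1 * \<epsilon>"
        using elim(1) t by (intro mult_right_mono) auto
      finally have t\<rho>: "t * \<rho> * (2 * D)\<^sup>2 \<le> \<epsilon>"
        by simp
      show ?case
      proof (intro impI allI)
        fix y J m z
        assume "ereal \<epsilon> < composite f h y0 - min_value (Rn n) (composite f h)"
          and run: "pbm_run (Rn n) f h (c * \<epsilon> / D\<^sup>2) \<beta> y0 y J m z"
        then have \<epsilon>: "\<epsilon> < F y0 - Fs"
          by (simp add: F_eq[OF y0] min_eq)
        obtain k N where kN: "y k \<in> effective_domain" "F (y k) - Fs \<le> \<epsilon>" "(\<Sum>i<k. J i) = enat N"
          "real N \<le> (2 + 1 / \<alpha>) * (8 * L powr (1 + \<alpha>) / (\<rho> * ((1 - \<beta>) * (t / 2)) powr \<alpha>)) *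
            ((1 + 1 / (\<alpha> * (\<beta> * (t / 2)))) * \<epsilon> powr - \<alpha>)"
          using pbm_run_bound[OF run[folded \<rho>_def] y0 min near elim(1) \<epsilon> t(1,2) t\<rho> \<beta> \<rho>
            small[unfolded \<Delta>_def]] by blast
        have "\<beta> * (t / 2) \<le> 1 * 1"
          using \<beta> t by (intro mult_mono) auto
        \<comment> \<open>Since \<open>\<beta> * (t / 2) \<le> 1\<close>, the summand 1 is absorbed
          and a single factor \<open>1 / \<beta>\<close> remains.\<close>
        then have "1 + 1 / (a * (\<beta> * (t / 2))) \<le> (1 + 1 / a) / (\<beta> * (t / 2))"
          using a \<beta> t by (simp add: field_simps)
        then have "(2 + 1 / a) * (8 * L powr (1 + a) / (\<rho> * ((1 - \<beta>) * (t / 2)) powr a)) *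
            ((1 + 1 / (a * (\<beta> * (t / 2)))) * \<epsilon> powr - a)
          \<le> (2 + 1 / a) * (8 * L powr (1 + a) / (\<rho> * ((1 - \<beta>) * (t / 2)) powr a)) *
            ((1 + 1 / a) / (\<beta> * (t / 2)) * \<epsilon> powr - a)"
          using a \<rho> by (intro mult_left_mono mult_right_mono) auto
        also have "\<dots> = C * (L powr (1 + a) * D\<^sup>2 / (\<beta> * (1 - \<beta>) powr a * \<epsilon> powr (1 + a)))"
        proof -
          have "((1 - \<beta>) * (t / 2)) powr a = (1 - \<beta>) powr a * (t / 2) powr a"
            by (rule powr_mult)
          moreover have "(t / 2) powr (1 + a) = (t / 2) * (t / 2) powr a" "\<epsilon> powr (1 + a) = \<epsilon> * \<epsilon> powr a"
            using t elim(1) by (simp_all add: powr_add)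
          \<comment> \<open>The remaining algebra with all powers abstracted to variables. The
            \<epsilon> in \<open>\<rho>\<close> joins \<open>\<epsilon> powr a\<close>, which
            produces the exponent \<open>1 + a\<close>.\<close>
          moreover have "u * (8 * l / ((c * \<epsilon> / d) * (b * T))) * (v / (\<beta> * s) * inverse e)
            = 8 * u * v / (c * (s * T)) * (l * d / (\<beta> * b * (\<epsilon> * e)))" for u v l d b T s e
            by (simp add: divide_simps)
          ultimately show ?thesis
            by (simp only: C_def \<rho>_def powr_minus)
        qed
        finally have "real N \<le> C * (L powr (1 + a) * D\<^sup>2 / (\<beta> * (1 - \<beta>) powr a * \<epsilon> powr (1 + a)))"
          using kN(4) by (simp only: \<alpha>_eq)
        then show "\<exists>k N. composite f h (y k) - min_value (Rn n) (composite f h) \<le> ereal \<epsilon> \<and>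
             (\<Sum>i<k. J i) = enat N \<and>
             real N \<le> C * (L powr (1 + a) * D\<^sup>2 / (\<beta> * (1 - \<beta>) powr a * \<epsilon> powr (1 + a)))"
          using kN by (intro exI[of _ k] exI[of _ N]) (simp add: F_eq min_eq)
      qed
    qed
  qed
qed

end
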